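(* Let $(T,\Sigma,\mu)$ be a non-atomic, $\sigma$-finite measure space, $\Phi$ a Musielak--Orlicz function on $T$, and $u\in L_0^\Phi\setminus\{0\}$ such that $K(u)\neq\emptyset$. Then a functional $f=f_v+f_{\mathrm s}\in(L_0^\Phi)^*$ (with order continuous component $f_v$, $v\in L^{\Phi^*}$, and singular component $f_{\mathrm s}$) is a support functional at $u$ if and only if, for any $k\in K(u)$, (i) $I_{\Phi^*}(v)+\|f_{\mathrm s}\|=1$, (ii) $\|f_{\mathrm s}\|=f_{\mathrm s}(ku)$, and (iii) $\operatorname{sgn}v(t)=\operatorname{sgn}u(t)$ and $|v(t)|\in\partial\Phi(t,|ku(t)|)$ for $\mu$-a.e. $t\in T$.
   Context: A function $\Phi\colon T\times[0,\infty]\to[0,\infty]$ is a Musielak--Orlicz function if, for $\mu$-a.e. $t\in T$: (i) $\Phi(t,\cdot)$ is convex and lower semi-continuous; (ii) $\Phi(t,0)=\lim_{u\downarrow0}\Phi(t,u)=0$ and $\Phi(t,\infty)=\infty$; and (iii) $\Phi(\cdot,u)$ is measurable for all $u\ge0$. The complementary function is $\Phi^*(t,v)=\sup_{u>0}(uv-\Phi(t,u))$, $v\ge0$; it is again a Musielak--Orlicz function. $\Phi'_-(t,u),\Phi'_+(t,u)\in[0,\infty]$ are the left and right derivatives of $\Phi(t,\cdot)$ at $u$, with the conventions $\Phi'_-(t,0)=0$, $\Phi'_-(t,u)=\infty$ if $\Phi(t,u)=\infty$, and $\Phi'_+(t,u)=\infty$ if $\Phi(t,\cdot)=\infty$ on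 $(u,\infty]$. Put $\partial\Phi(t,u)=[\Phi'_-(t,u),\Phi'_+(t,u)]$. $L^0$ is the space of real-valued measurable functions on $T$ (equality $\mu$-a.e.), $I_\Phi(u)=\int_T\Phi(t,|u(t)|)\,d\mu$, $L^\Phi=\{u\in L^0: I_\Phi(\lambda u)<\infty\text{ for some }\lambda>0\}$, $\tilde L^\Phi=\{u\in L^0:I_\Phi(u)<\infty\}$. The Orlicz norm is $\|u\|_{\Phi,0}=\sup\{|\int_T uv\,d\mu|: v\in\tilde L^{\Phi^*},\ I_{\Phi^*}(v)\le1\}$, and it coincides on $L^\Phi$ with the Amemiya norm $\inf_{k>0}\frac1k(1+I_\Phi(ku))$. $L_0^\Phi$ is the Banach space $L^\Phi$ with the norm $\|\cdot\|_{\Phi,0}$. $K(u)$ is the set of all $k>0$ at which the infimum $\inf_{k>0}\frac1k(1+I_\Phi(ku))$ is attained. For $f\in(L_0^\Phi)^*$, $\|f\|=\sup_{u\neq0}|f(u)|/\|u\|_{\Phi,0}$. For $v\in L^{\Phi^*}$, $f_v(u)=\int_T uv\,d\mu$. Every $f\in(L^\Phi)^*$ decomposes uniquely as $f=f_{\mathrm c}+f_{\mathrm s}$, where $f_{\mathrm c}=f_v$ for some $v\in L^{\Phi^*}$ (order continuous component) and $f_{\mathrm s}$ is purely singular, i.e. has zero order continuous component. For a positive functional $f$ and $0\le u\in L^\Phi$, $f_{\mathrm c}(u)=\inf\{\sup_n f(u_n):0\le u_n\uparrow u\}$ and $f_{\mathrm s}(u)=\sup\{\inf_n f(u_n):u\ge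 u_n\downarrow0\}$; for general $f$ one uses the positive and negative parts. A support functional at $u\ne0$ is an $f\in(L_0^\Phi)^*$ with $\|f\|=1$ and $f(u)=\|u\|_{\Phi,0}$.
   Formalization: In (iii), sgn v(t) = sgn u(t) is required only where u(t) and v(t) are both nonzero; with sgn 0 = 0 the equivalence fails, e.g. Φ(t,r) = r + r² on [0,2], u = 1_[0,1], v = 3 on [0,1] and v = 1 on (1,2]. *)

theory Defs
  imports "HOL-Analysis.Analysis"
begin

definition nonatomic :: "'a measure \<Rightarrow> bool" where
  "nonatomic M \<longleftrightarrow> (\<forall>A\<in>sets M. emeasure M A > 0 \<longrightarrow>
     (\<exists>B\<in>sets M. B \<subseteq> A \<and> 0 < emeasure M B \<and> emeasure M B < emeasure M A))"

text \<open>The extended half-line $[0,\infty]$ is the type \<^typ>\<open>ennreal\<close>, in which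
  \<open>0 * \<infinity> = 0\<close> and subtraction is truncated at \<open>0\<close>.\<close>

definition convex_ext :: "(ennreal \<Rightarrow> ennreal) \<Rightarrow> bool" where
  "convex_ext \<phi> \<longleftrightarrow> (\<forall>x y. \<forall>a\<ge>0. \<forall>b\<ge>0. a + b = 1 \<longrightarrow> \<phi> (a * x + b * y) \<le> a * \<phi> x + b * \<phi> y)"

definition lsc_ext :: "(ennreal \<Rightarrow> ennreal) \<Rightarrow> bool" where
  "lsc_ext \<phi> \<longleftrightarrow> (\<forall>u. \<phi> u \<le> Liminf (at u) \<phi>)"

definition musielak_orlicz :: "'a measure \<Rightarrow> ('a \<Rightarrow> ennreal \<Rightarrow> ennreal) \<Rightarrow> bool" where
  "musielak_orlicz M \<Phi> \<longleftrightarrow>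
     (AE t in M. convex_ext (\<Phi> t) \<and> lsc_ext (\<Phi> t) \<and>
        \<Phi> t 0 = 0 \<and> (\<Phi> t \<longlongrightarrow> 0) (at_right 0) \<and> \<Phi> t \<infinity> = \<infinity>) \<and>
     (\<forall>u::real. u \<ge> 0 \<longrightarrow> (\<lambda>t. \<Phi> t (ennreal u)) \<in> borel_measurable M)"

text \<open>Truncated subtraction does not affect the supremum: for a Musielak--Orlicz function
  \<open>u * v - \<Phi> t u\<close> tends to \<open>0\<close> as \<open>u\<close> decreases to \<open>0\<close>, so for a.e. \<open>t\<close> the
  supremum of the untruncated differences is already nonnegative.\<close>

definition compl_fun :: "('a \<Rightarrow> ennreal \<Rightarrow> ennreal) \<Rightarrow> 'a \<Rightarrow> ennreal \<Rightarrow> ennreal" where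
  "compl_fun \<Phi> t v = (SUP u\<in>{0<..<\<infinity>}. u * v - \<Phi> t u)"

text \<open>Since \<open>\<Phi> t\<close> is nondecreasing for a.e. \<open>t\<close>, the numerators of the difference quotients
  below are genuine differences.\<close>

definition left_deriv :: "('a \<Rightarrow> ennreal \<Rightarrow> ennreal) \<Rightarrow> 'a \<Rightarrow> ennreal \<Rightarrow> ennreal" where
  "left_deriv \<Phi> t u =
     (if u = 0 then 0
      else if \<Phi> t u = \<infinity> then \<infinity>
      else Lim (at_left u) (\<lambda>w. (\<Phi> t u - \<Phi> t w) / (u - w)))"

definition right_deriv :: "('a \<Rightarrow> ennreal \<Rightarrow> ennreal) \<Rightarrow> 'a \<Rightarrow> ennreal \<Rightarrow> ennreal" where
  "right_deriv \<Phi> t u =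
     (if \<forall>w>u. \<Phi> t w = \<infinity> then \<infinity>
      else Lim (at_right u) (\<lambda>w. (\<Phi> t w - \<Phi> t u) / (w - u)))"

definition subdiff :: "('a \<Rightarrow> ennreal \<Rightarrow> ennreal) \<Rightarrow> 'a \<Rightarrow> ennreal \<Rightarrow> ennreal set" where
  "subdiff \<Phi> t u = {left_deriv \<Phi> t u .. right_deriv \<Phi> t u}"

definition modular :: "'a measure \<Rightarrow> ('a \<Rightarrow> ennreal \<Rightarrow> ennreal) \<Rightarrow> ('a \<Rightarrow> real) \<Rightarrow> ennreal" where
  "modular M \<Phi> u = (\<integral>\<^sup>+ t. \<Phi> t (ennreal \<bar>u t\<bar>) \<partial>M)"

text \<open>Elements of the spaces are functions, not classes modulo a.e. equality; being zero in
  the space is expressed by \<open>AE t in M. u t = 0\<close>.\<close>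

definition mo_space :: "'a measure \<Rightarrow> ('a \<Rightarrow> ennreal \<Rightarrow> ennreal) \<Rightarrow> ('a \<Rightarrow> real) set" where
  "mo_space M \<Phi> =
     {u \<in> borel_measurable M. \<exists>c::real. c > 0 \<and> modular M \<Phi> (\<lambda>t. c * u t) < \<infinity>}"

definition mo_class :: "'a measure \<Rightarrow> ('a \<Rightarrow> ennreal \<Rightarrow> ennreal) \<Rightarrow> ('a \<Rightarrow> real) set" where
  "mo_class M \<Phi> = {u \<in> borel_measurable M. modular M \<Phi> u < \<infinity>}"

definition orlicz_norm ::
  "'a measure \<Rightarrow> ('a \<Rightarrow> ennreal \<Rightarrow> ennreal) \<Rightarrow> ('a \<Rightarrow> real) \<Rightarrow> real" where
  "orlicz_norm M \<Phi> u =
     (SUP v\<in>{v \<in> mo_class M (compl_fun \<Phi>). modular M (compl_fun \<Phi>) v \<le> 1}.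
        \<bar>LINT t|M. u t * v t\<bar>)"

definition amemiya ::
  "'a measure \<Rightarrow> ('a \<Rightarrow> ennreal \<Rightarrow> ennreal) \<Rightarrow> ('a \<Rightarrow> real) \<Rightarrow> real \<Rightarrow> ennreal" where
  "amemiya M \<Phi> u k = (1 + modular M \<Phi> (\<lambda>t. k * u t)) / ennreal k"

definition K_set ::
  "'a measure \<Rightarrow> ('a \<Rightarrow> ennreal \<Rightarrow> ennreal) \<Rightarrow> ('a \<Rightarrow> real) \<Rightarrow> real set" where
  "K_set M \<Phi> u = {k. k > 0 \<and> amemiya M \<Phi> u k = (INF l\<in>{0<..}. amemiya M \<Phi> u l)}"

text \<open>Functionals matter only through their values on \<^term>\<open>mo_space M \<Phi>\<close>. Boundedness makes
  them invariant under modification of the argument on a null set.\<close>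

definition mo_dual ::
  "'a measure \<Rightarrow> ('a \<Rightarrow> ennreal \<Rightarrow> ennreal) \<Rightarrow> (('a \<Rightarrow> real) \<Rightarrow> real) set" where
  "mo_dual M \<Phi> = {f.
     (\<forall>w\<in>mo_space M \<Phi>. \<forall>z\<in>mo_space M \<Phi>. f (\<lambda>t. w t + z t) = f w + f z) \<and>
     (\<forall>c. \<forall>w\<in>mo_space M \<Phi>. f (\<lambda>t. c * w t) = c * f w) \<and>
     (\<exists>C. \<forall>w\<in>mo_space M \<Phi>. \<bar>f w\<bar> \<le> C * orlicz_norm M \<Phi> w)}"

definition dual_norm ::
  "'a measure \<Rightarrow> ('a \<Rightarrow> ennreal \<Rightarrow> ennreal) \<Rightarrow> (('a \<Rightarrow> real) \<Rightarrow> real) \<Rightarrow> real" where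
  "dual_norm M \<Phi> f =
     (SUP w\<in>{w \<in> mo_space M \<Phi>. \<not> (AE t in M. w t = 0)}. \<bar>f w\<bar> / orlicz_norm M \<Phi> w)"

text \<open>The positive part of a functional, on nonnegative arguments; the negative part of \<open>f\<close>
  is the positive part of \<open>- f\<close>.\<close>

definition pos_part_fun ::
  "'a measure \<Rightarrow> ('a \<Rightarrow> ennreal \<Rightarrow> ennreal) \<Rightarrow> (('a \<Rightarrow> real) \<Rightarrow> real) \<Rightarrow> ('a \<Rightarrow> real) \<Rightarrow> real" where
  "pos_part_fun M \<Phi> f u = (SUP w\<in>{w \<in> mo_space M \<Phi>. AE t in M. 0 \<le> w t \<and> w t \<le> u t}. f w)"

text \<open>The order continuous component of a positive functional, on nonnegative arguments.\<close>

definition oc_part_pos ::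
  "'a measure \<Rightarrow> ('a \<Rightarrow> ennreal \<Rightarrow> ennreal) \<Rightarrow> (('a \<Rightarrow> real) \<Rightarrow> real) \<Rightarrow> ('a \<Rightarrow> real) \<Rightarrow> real" where
  "oc_part_pos M \<Phi> g u =
     (INF U\<in>{U. (\<forall>n::nat. U n \<in> mo_space M \<Phi>) \<and>
                 (AE t in M. 0 \<le> U 0 t \<and> incseq (\<lambda>n. U n t) \<and> (\<lambda>n. U n t) \<longlonglongrightarrow> u t)}.
        SUP n. g (U n))"

text \<open>The order continuous component of an arbitrary functional, extended by linearity from the
  positive and negative parts of the functional and of the argument.\<close>

definition oc_part ::
  "'a measure \<Rightarrow> ('a \<Rightarrow> ennreal \<Rightarrow> ennreal) \<Rightarrow> (('a \<Rightarrow> real) \<Rightarrow> real) \<Rightarrow> ('a \<Rightarrow> real) \<Rightarrow> real" where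
  "oc_part M \<Phi> f w =
     (let fp = pos_part_fun M \<Phi> f; fn = pos_part_fun M \<Phi> (\<lambda>z. - f z);
          wp = (\<lambda>t. max (w t) 0); wn = (\<lambda>t. max (- w t) 0)
      in (oc_part_pos M \<Phi> fp wp - oc_part_pos M \<Phi> fp wn)
       - (oc_part_pos M \<Phi> fn wp - oc_part_pos M \<Phi> fn wn))"

definition purely_singular ::
  "'a measure \<Rightarrow> ('a \<Rightarrow> ennreal \<Rightarrow> ennreal) \<Rightarrow> (('a \<Rightarrow> real) \<Rightarrow> real) \<Rightarrow> bool" where
  "purely_singular M \<Phi> s \<longleftrightarrow> s \<in> mo_dual M \<Phi> \<and> (\<forall>w\<in>mo_space M \<Phi>. oc_part M \<Phi> s w = 0)"

definition has_components ::
  "'a measure \<Rightarrow> ('a \<Rightarrow> ennreal \<Rightarrow> ennreal) \<Rightarrow> (('a \<Rightarrow> real) \<Rightarrow> real) \<Rightarrow>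
   ('a \<Rightarrow> real) \<Rightarrow> (('a \<Rightarrow> real) \<Rightarrow> real) \<Rightarrow> bool" where
  "has_components M \<Phi> f v s \<longleftrightarrow>
     v \<in> mo_space M (compl_fun \<Phi>) \<and> purely_singular M \<Phi> s \<and>
     (\<forall>w\<in>mo_space M \<Phi>. f w = (LINT t|M. w t * v t) + s w)"

definition support_functional ::
  "'a measure \<Rightarrow> ('a \<Rightarrow> ennreal \<Rightarrow> ennreal) \<Rightarrow> (('a \<Rightarrow> real) \<Rightarrow> real) \<Rightarrow> ('a \<Rightarrow> real) \<Rightarrow> bool" where
  "support_functional M \<Phi> f u \<longleftrightarrow>
     f \<in> mo_dual M \<Phi> \<and> dual_norm M \<Phi> f = 1 \<and> f u = orlicz_norm M \<Phi> u"

text \<open>Equality of signs is understood up to zeros, which match either sign. Requiring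
  \<open>sgn y = sgn x\<close> also when \<open>x\<close> or \<open>y\<close> vanishes would make the characterization of support
  functionals false. For \<open>\<Phi> t r = r + r\<^sup>2\<close> on $[0,2]$ with Lebesgue measure and \<open>u\<close> the
  indicator of $[0,1]$, one has \<open>K(u) = {1}\<close>, and \<open>v = 3\<close> on $[0,1]$, \<open>v = 1\<close> on $(1,2]$ gives
  a support functional at \<open>u\<close>, although \<open>u = 0 < v\<close> on $(1,2]$. If \<open>\<Phi> t\<close> vanishes near \<open>0\<close>,
  \<open>v = 0\<close> may likewise be forced where \<open>u \<noteq> 0\<close>.\<close>

definition same_sgn :: "real \<Rightarrow> real \<Rightarrow> bool" where
  "same_sgn y x \<longleftrightarrow> (x \<noteq> 0 \<and> y \<noteq> 0 \<longrightarrow> sgn y = sgn x)"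

end

theory Submission
  imports Defs
begin

text \<open>The argument is Fenchel duality for the modular \<open>I\<close> of \<open>\<Phi>\<close>. By the Amemiya formula,
  \<open>\<parallel>f\<parallel> \<le> 1\<close> means \<open>f w \<le> 1 + I w\<close> for all \<open>w\<close>, that is, the conjugate of \<open>I\<close> at \<open>f\<close> is at
  most \<open>1\<close>. At \<open>f = f\<^sub>v + s\<close> this conjugate is \<open>J v + \<parallel>s\<parallel>\<close>, where \<open>J\<close> is the modular of
  \<open>\<Phi>\<^sup>*\<close>, because a singular functional only sees a function near a shrinking sequence of sets,
  where the integrals do not see it. For \<open>k \<in> K(u)\<close>, \<open>f\<close> supports at \<open>u\<close> iff
  \<open>f (k u) = 1 + I (k u)\<close>, which is the equality case of
  \<open>f (k u) \<le> (I (k u) + J v) + \<parallel>s\<parallel> \<le> I (k u) + 1\<close>; the pointwise equality case of Young's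
  inequality is the subdifferential condition. The Amemiya formula itself comes from a
  one-dimensional Lagrange multiplier for the constraint \<open>J v \<le> 1\<close>.\<close>

subsection \<open>Young functions\<close>

text \<open>The half of the Amemiya formula that Young's inequality does not give needs
  biconjugation under the integral sign: \<open>I\<close> must be recovered from \<open>J\<close>.
  Sections may take the value infinity and are only known to be measurable at constants, so no
  maximiser is selected. Lower semicontinuity and monotonicity reduce each pointwise supremum to
  nonnegative rationals, and a countable supremum is pulled out of the integral by patching
  near-maximisers; \<sigma>-finiteness keeps their modulars finite. For \<open>s\<close>, pure
  singularity only says that the order continuous components of its positive and negative parts
  cancel. Each has to be shown to vanish before sets can be found near which \<open>s\<close> lives.
  Those sets decouple the two suprema behind \<open>J v\<close> and the norm of \<open>s\<close>:
  one test function serves the integrals, another one serves \<open>s\<close>.\<close>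

text \<open>The minuend is finite; if it and \<open>a\<close> were both infinite, the equivalence
  would fail.\<close>

lemma ennreal_mult_diff_le_iff:
  "0 \<le> x \<Longrightarrow> 0 \<le> y \<Longrightarrow> ennreal x * ennreal y - a \<le> d \<longleftrightarrow> ennreal (x * y) \<le> a + d"
  by (simp add: ennreal_minus_le_iff flip: ennreal_mult)

text \<open>The conditions on a single section, kept apart from measurability so that Young duality
  becomes a matter of one variable.\<close>

locale young_function =
  fixes \<phi> :: "ennreal \<Rightarrow> ennreal"
  assumes convex: "convex_ext \<phi>" and lsc: "lsc_ext \<phi>"
    and zero [simp]: "\<phi> 0 = 0" and top [simp]: "\<phi> top = top"
begin

lemma convex_real:
  assumes "0 \<le> x" "0 \<le> y" "0 \<le> \<theta>" "\<theta> \<le> 1"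
  shows "\<phi> (ennreal (\<theta> * x + (1 - \<theta>) * y)) \<le> ennreal \<theta> * \<phi> (ennreal x) + ennreal (1 - \<theta>) * \<phi> (ennreal y)"
proof -
  have "ennreal \<theta> + ennreal (1 - \<theta>) = 1"
    using assms by (simp flip: ennreal_plus)
  then have "\<phi> (ennreal \<theta> * ennreal x + ennreal (1 - \<theta>) * ennreal y) \<le> ennreal \<theta> * \<phi> (ennreal x) + ennreal (1 - \<theta>) * \<phi> (ennreal y)"
    using convex by (simp add: convex_ext_def)
  moreover have "ennreal \<theta> * ennreal x + ennreal (1 - \<theta>) * ennreal y = ennreal (\<theta> * x + (1 - \<theta>) * y)"
    using assms by (simp add: ennreal_mult ennreal_plus)
  ultimately show ?thesis by simp
qed

text \<open>A point between 0 and \<open>y\<close> is a convex combination of the two, and \<phi>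
  vanishes at 0.\<close>

lemma mono: "x \<le> y \<Longrightarrow> \<phi> x \<le> \<phi> y"
proof (cases "y = top \<or> y = 0")
  case False
  assume "x \<le> y"
  with False obtain a b where ab: "x = ennreal a" "y = ennreal b" "0 \<le> a" "a \<le> b" "0 < b"
    by (cases x; cases y) (auto simp: top_unique)
  have "\<phi> (ennreal ((a/b) * b + (1 - a/b) * 0)) \<le> ennreal (a/b) * \<phi> (ennreal b) + ennreal (1 - a/b) * \<phi> (ennreal 0)"
    using ab by (intro convex_real) auto
  also have "\<dots> \<le> 1 * \<phi> (ennreal b)"
    using ab mult_right_mono[of "ennreal (a / b)" 1 "\<phi> (ennreal b)"] by (simp add: ennreal_le_1)
  finally show ?thesis using ab by simp
qed (auto simp: top_unique)

text \<open>Lower semicontinuity is applied on the left half of a neighbourhood. For a nondecreasing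
  function this is left continuity, and it lets values at rationals recover \<phi>.\<close>

lemma rational_below:
  assumes "c < \<phi> (ennreal x)"
  obtains q where "q \<in> \<rat>" "0 \<le> q" "q < x" "c < \<phi> (ennreal q)"
proof -
  have x: "0 < x" using assms by (metis ennreal_neg zero not_less_zero not_le_imp_less)
  have "c < Liminf (at (ennreal x)) \<phi>"
    using lsc assms unfolding lsc_ext_def by (meson order_less_le_trans)
  then have "eventually (\<lambda>y. c < \<phi> y) (at (ennreal x))"
    by (rule less_LiminfD)
  then have "eventually (\<lambda>y. c < \<phi> y) (at_left (ennreal x))"
    by (rule filter_leD[rotated]) (simp add: at_le)
  then obtain b where b: "b < ennreal x" "\<And>y. b < y \<Longrightarrow> y < ennreal x \<Longrightarrow> c < \<phi> y"
    using x by (subst (asm) eventually_at_left[of 0]) auto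
  then obtain b' where b': "b = ennreal b'" "0 \<le> b'" "b' < x"
    by (cases b) (auto simp: ennreal_less_iff)
  then obtain q where "q \<in> \<rat>" "b' < q" "q < x"
    using Rats_dense_in_real by blast
  with b b' that[of q] show thesis
    by (simp add: ennreal_less_iff)
qed

definition conj :: "ennreal \<Rightarrow> ennreal" where
  "conj v = (SUP u\<in>{0<..<top}. u * v - \<phi> u)"

text \<open>Bounds on the conjugate become additive inequalities over real \<open>u\<close>, free of
  truncated subtraction. Admitting \<open>u = 0\<close> is harmless, since the left side is 0
  there.\<close>

lemma conj_le_iff:
  assumes "0 \<le> y" shows "conj (ennreal y) \<le> d \<longleftrightarrow> (\<forall>u\<ge>0. ennreal (u * y) \<le> \<phi> (ennreal u) + d)"
proof -
  have "conj (ennreal y) \<le> d \<longleftrightarrow> (\<forall>u\<in>{0<..<top}. u * ennreal y - \<phi> u \<le> d)"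
    by (simp add: conj_def SUP_le_iff)
  also have "\<dots> \<longleftrightarrow> (\<forall>u>0. ennreal (u * y) \<le> \<phi> (ennreal u) + d)"
  proof -
    have "{0<..<top} = ennreal ` {0<..}"
    proof (intro set_eqI iffI)
      fix x assume "x \<in> {0<..<top::ennreal}"
      then show "x \<in> ennreal ` {0<..}" by (cases x) auto
    qed auto
    then show ?thesis using assms
      by (auto simp: ennreal_mult_diff_le_iff)
  qed
  also have "\<dots> \<longleftrightarrow> (\<forall>u\<ge>0. ennreal (u * y) \<le> \<phi> (ennreal u) + d)"
  proof (intro iffI allI impI)
    fix u :: real assume "\<forall>u>0. ennreal (u * y) \<le> \<phi> (ennreal u) + d" "0 \<le> u"
    then show "ennreal (u * y) \<le> \<phi> (ennreal u) + d" by (cases "u = 0") auto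
  qed auto
  finally show ?thesis .
qed

lemma young: "0 \<le> x \<Longrightarrow> 0 \<le> y \<Longrightarrow> ennreal (x * y) \<le> \<phi> (ennreal x) + conj (ennreal y)"
  using conj_le_iff by blast

text \<open>Moving \<open>u\<close> down to a nearby rational loses little of \<open>u * y\<close>
  and does not increase \<phi>.\<close>

lemma conj_eq_rational_sup:
  assumes "0 \<le> y"
  shows "conj (ennreal y) = (SUP q\<in>{q\<in>\<rat>. 0 \<le> q}. ennreal q * ennreal y - \<phi> (ennreal q))"
proof (rule antisym)
  let ?S = "SUP q\<in>{q\<in>\<rat>. 0 \<le> q}. ennreal q * ennreal y - \<phi> (ennreal q)"
  have S: "ennreal (q * y) \<le> \<phi> (ennreal q) + ?S" if "q \<in> \<rat>" "0 \<le> q" for q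
  proof -
    have "ennreal q * ennreal y - \<phi> (ennreal q) \<le> ?S"
      using that by (intro SUP_upper) auto
    then show ?thesis using that assms by (simp add: ennreal_mult_diff_le_iff)
  qed
  show "conj (ennreal y) \<le> ?S"
    unfolding conj_le_iff[OF assms]
  proof (intro allI impI)
    fix u :: real assume u: "0 \<le> u"
    show "ennreal (u * y) \<le> \<phi> (ennreal u) + ?S"
    proof (rule dense_le)
      fix z assume z: "z < ennreal (u * y)"
      then obtain r where r: "z = ennreal r" "0 \<le> r" "r < u * y"
        by (cases z) (auto simp: ennreal_less_iff)
      with assms u have y: "0 < y" "r / y < u" 
        by (cases "y = 0"; auto simp: field_simps)+
      then obtain q where q: "q \<in> \<rat>" "r / y < q" "q < u" using Rats_dense_in_real by blast
      have q0: "0 \<le> q" using q r y by (meson divide_nonneg_pos order.trans order_less_imp_le)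
      have "z \<le> ennreal (q * y)" using q y r by (auto simp: field_simps intro!: ennreal_leI)
      also have "\<dots> \<le> \<phi> (ennreal q) + ?S" using S q q0 by blast
      also have "\<dots> \<le> \<phi> (ennreal u) + ?S" using q by (intro add_right_mono mono ennreal_leI) auto
      finally show "z \<le> \<phi> (ennreal u) + ?S" .
    qed
  qed
  have "ennreal q * ennreal y - \<phi> (ennreal q) \<le> conj (ennreal y)" if "0 \<le> q" for q
    using young[OF that assms] that assms by (simp add: ennreal_mult_diff_le_iff)
  then show "?S \<le> conj (ennreal y)" by (auto intro!: SUP_least)
qed

text \<open>Consecutive chord slopes increase. This is convexity at \<open>y\<close>, seen as a
  mixture of \<open>x\<close> and \<open>z\<close>, cleared of denominators; values are real because
  \<phi> is finite up to \<open>z\<close>.\<close>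

lemma slope:
  assumes "0 \<le> x" "x < y" "y < z" "\<phi> (ennreal z) < top"
  shows "(enn2real (\<phi> (ennreal y)) - enn2real (\<phi> (ennreal x))) * (z - y)
       \<le> (enn2real (\<phi> (ennreal z)) - enn2real (\<phi> (ennreal y))) * (y - x)"
proof -
  define \<theta> where "\<theta> = (z - y) / (z - x)"
  have \<theta>: "0 \<le> \<theta>" "\<theta> \<le> 1" "1 - \<theta> = (y - x) / (z - x)" using assms by (auto simp: \<theta>_def field_simps)
  have "\<theta> * x + (1 - \<theta>) * z = ((z - y) * x + (y - x) * z) / (z - x)"
    by (simp add: \<theta>(3)) (simp add: \<theta>_def add_divide_distrib)
  also have "\<dots> = y" using assms by (simp add: field_simps)
  finally have y: "\<theta> * x + (1 - \<theta>) * z = y" .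
  have le: "\<phi> (ennreal x) \<le> \<phi> (ennreal z)" "\<phi> (ennreal y) \<le> \<phi> (ennreal z)"
    using assms by (auto intro!: mono ennreal_leI)
  obtain A B C where ABC: "\<phi> (ennreal x) = ennreal A" "\<phi> (ennreal y) = ennreal B" "\<phi> (ennreal z) = ennreal C"
    "0 \<le> A" "0 \<le> B" "0 \<le> C"
    using assms(4) le by (cases "\<phi> (ennreal x)"; cases "\<phi> (ennreal y)"; cases "\<phi> (ennreal z)") (auto simp: top_unique)
  have "ennreal B \<le> ennreal \<theta> * ennreal A + ennreal (1 - \<theta>) * ennreal C"
    using convex_real[of x z \<theta>, unfolded y ABC] assms \<theta>(1,2) by simp
  also have "\<dots> = ennreal (\<theta> * A + (1 - \<theta>) * C)"
    using \<theta>(1,2) ABC(4-) by (simp add: ennreal_mult ennreal_plus)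
  finally have "B \<le> \<theta> * A + (1 - \<theta>) * C" 
    using ABC \<theta>(1,2) by (simp add: ennreal_le_iff del: ennreal_plus)
  also have "\<dots> = ((z - y) * A + (y - x) * C) / (z - x)"
    by (simp add: \<theta>(3)) (simp add: \<theta>_def add_divide_distrib)
  finally have "B * (z - x) \<le> (z - y) * A + (y - x) * C"
    using assms by (simp add: field_simps)
  then show ?thesis using ABC by (simp add: algebra_simps)
qed


text \<open>One-dimensional Fenchel-Moreau with rational slopes: some affine minorant of \<phi>
  exceeds \<open>c\<close> at \<open>x\<close>. A chord slightly to the left of \<open>x\<close>
  replaces the tangent at \<open>x\<close>, where value or slope may be infinite.\<close>

lemma biconjugate:
  assumes c: "c < \<phi> (ennreal x)"
  obtains q where "q \<in> \<rat>" "0 \<le> q" "c < ennreal x * ennreal q - conj (ennreal q)"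
proof -
  obtain y where y: "0 \<le> y" "y < x" "c < \<phi> (ennreal y)"
    using rational_below[OF c] by metis
  obtain c' where c': "c = ennreal c'" "0 \<le> c'"
    using c by (cases c) auto
  note result = that
  \<comment> \<open>It remains to find a minorant \<open>u * q - d\<close> whose value at
    \<open>x\<close> exceeds \<open>c'\<close>.\<close>
  have *: thesis if q: "q \<in> \<rat>" "0 \<le> q" and d: "\<And>u. 0 \<le> u \<Longrightarrow> ennreal (u * q) \<le> \<phi> (ennreal u) + ennreal d"
    and less: "c' < x * q - d" and "0 \<le> d" for q d
  proof (rule result[OF q])
    have "c < ennreal x * ennreal q - ennreal d"
      using q y c' less \<open>0 \<le> d\<close> by (simp add: ennreal_minus ennreal_less_iff flip: ennreal_mult)
    also have "\<dots> \<le> ennreal x * ennreal q - conj (ennreal q)"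
      using d q by (intro ennreal_minus_mono order_refl) (simp add: conj_le_iff)
    finally show "c < \<dots>" .
  qed
  show thesis
  proof (cases "\<exists>w. 0 \<le> w \<and> w < x \<and> \<phi> (ennreal w) = top")
    case True
    then obtain w where w: "0 \<le> w" "w < x" "\<phi> (ennreal w) = top" by blast
    \<comment> \<open>Since \<phi> is infinite beyond \<open>w\<close>, every line of nonnegative
      slope vanishing at \<open>w\<close> is a minorant. A large natural slope lifts it above
      \<open>c'\<close> at \<open>x\<close>.\<close>
    define q where "q = real (nat \<lceil>(c' + 1) / (x - w)\<rceil>)"
    have "(c' + 1) / (x - w) \<le> q" unfolding q_def by linarith
    then have q: "c' + 1 \<le> q * (x - w)" using w by (simp add: field_simps)
    have q0: "q \<in> \<rat>" "0 \<le> q" by (auto simp: q_def)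
    show thesis
    proof (rule *[of q "w * q"])
      fix u :: real assume "0 \<le> u"
      show "ennreal (u * q) \<le> \<phi> (ennreal u) + ennreal (w * q)"
      proof (cases "u \<le> w")
        case True
        then have "ennreal (u * q) \<le> ennreal (w * q)"
          using q0 by (intro ennreal_leI mult_right_mono)
        then show ?thesis by (simp add: add_increasing)
      next
        case False
        then have "\<phi> (ennreal u) = top"
          using mono[of "ennreal w" "ennreal u"] w by (simp add: ennreal_leI top_unique)
        then show ?thesis by simp
      qed
    qed (use q q0 w c' in \<open>auto simp: algebra_simps\<close>)
  next
    case False
    define F where "F u = enn2real (\<phi> (ennreal u))" for u
    have F: "\<phi> (ennreal u) = ennreal (F u)" if "0 \<le> u" "u < x" for u
      using False that by (auto simp: F_def less_top intro!: ennreal_enn2real[symmetric])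
    have F0: "0 \<le> F u" for u by (simp add: F_def)
    have Y: "c' < F y" using y c' by (simp add: F ennreal_less_iff)
    \<comment> \<open>One third of the gap pays for lowering the chord, one for tilting it, and the
      last keeps the final inequality strict.\<close>
    define \<delta> where "\<delta> = (F y - c') / 3"
    define w where "w = (x + y) / 2"
    have \<delta>: "0 < \<delta>" using Y by (simp add: \<delta>_def)
    have w: "y < w" "w < x" "0 \<le> w" using y by (auto simp: w_def)
    have mF: "F a \<le> F b" if "0 \<le> a" "a \<le> b" "b < x" for a b
      using mono[of "ennreal a" "ennreal b"] that by (simp add: F ennreal_leI F0)
    \<comment> \<open>By convexity \<open>F z - F y\<close> is at most
      \<open>\<theta> * (F w - F y)\<close>, so this choice keeps it below \<delta>. The summand 1
      keeps the denominator positive when \<open>F w = F y\<close>.\<close>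
    define \<theta> where "\<theta> = min 1 (\<delta> / (F w - F y + 1))"
    have W: "F y \<le> F w" using mF w y by simp
    have \<theta>: "0 < \<theta>" "\<theta> \<le> 1" using \<delta> W by (auto simp: \<theta>_def)
    have "\<theta> * (F w - F y) \<le> \<delta> / (F w - F y + 1) * (F w - F y)"
      using W by (intro mult_right_mono) (auto simp: \<theta>_def)
    also have "\<dots> \<le> \<delta>" using W \<delta> by (simp add: field_simps)
    finally have \<theta>W: "\<theta> * (F w - F y) \<le> \<delta>" .
    define z where "z = \<theta> * w + (1 - \<theta>) * y"
    have "z - y = \<theta> * (w - y)" by (simp add: z_def algebra_simps)
    then have zy: "y < z" using \<theta> w by (smt (verit) mult_pos_pos)
    have "w - z = (1 - \<theta>) * (w - y)" by (simp add: z_def algebra_simps)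
    then have zx: "z < x" using \<theta> w by (smt (verit) mult_nonneg_nonneg)
    have "ennreal (F z) \<le> ennreal \<theta> * ennreal (F w) + ennreal (1 - \<theta>) * ennreal (F y)"
      using convex_real[of w y \<theta>] \<theta> w y zx zy F[of z] F[of w] F[of y] by (simp flip: z_def)
    also have "\<dots> = ennreal (\<theta> * F w + (1 - \<theta>) * F y)"
      using \<theta> F0 by (simp add: ennreal_mult ennreal_plus)
    finally have "F z \<le> \<theta> * F w + (1 - \<theta>) * F y" 
      using \<theta> F0 by (simp add: ennreal_le_iff del: ennreal_plus)
    then have Z: "F z - F y \<le> \<delta>" using \<theta>W by (simp add: algebra_simps)
    have YZ: "F y \<le> F z" using mF zy zx y by simp
    define p where "p = (F z - F y) / (z - y)"
    have p: "0 \<le> p" "p * (z - y) = F z - F y" using YZ zy by (auto simp: p_def)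
    obtain q where q: "q \<in> \<rat>" "0 \<le> q" "q \<le> p" "(p - q) * y \<le> \<delta>"
    proof (cases "p = 0")
      case True then show ?thesis using that[of 0] \<delta> by simp
    next
      case False
      then have "max 0 (p - \<delta> / (y + 1)) < p" using p \<delta> y by auto
      then obtain q where q: "q \<in> \<rat>" "max 0 (p - \<delta> / (y + 1)) < q" "q < p" using Rats_dense_in_real by blast
      then have "(p - q) * y \<le> \<delta> / (y + 1) * y" using y by (intro mult_right_mono) auto
      also have "\<dots> \<le> \<delta>" using y \<delta> by (simp add: field_simps)
      finally show ?thesis using that[of q] q by auto
    qed
    \<comment> \<open>The chord lies above \<phi> between \<open>y\<close> and \<open>z\<close>,
      hence the shift by \<open>F z - F y\<close>. Reducing its slope from \<open>p\<close> to
      \<open>q\<close> about \<open>y\<close> raises it on the left by at most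
      \<open>(p - q) * y\<close>, hence the last term.\<close>
    define d where "d = q * y - F y + (F z - F y) + (p - q) * y"
    have line: "u * q \<le> F u + d" if u: "0 \<le> u" "\<phi> (ennreal u) < top" for u
    proof -
      have S: "(F b - F a) * (e - b) \<le> (F e - F b) * (b - a)" if "0 \<le> a" "a < b" "b < e" "\<phi> (ennreal e) < top" for a b e
        using slope[OF that] by (simp add: F_def)
      consider "u < y" | "y \<le> u" "u \<le> z" | "z < u" by linarith
      then show ?thesis
      proof cases
        case 1
        have "(F y - F u) * (z - y) \<le> (F z - F y) * (y - u)"
          using 1 u zy zx S[of u y z] by (simp add: F)
        also have "\<dots> = p * (y - u) * (z - y)" by (simp flip: p(2))
        finally have "F y - F u \<le> p * (y - u)" using zy by simp
        moreover have "(p - q) * (y - u) \<le> (p - q) * y" using q u by (intro mult_left_mono) auto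
        ultimately show ?thesis using YZ by (simp add: d_def algebra_simps)
      next
        case 2
        have "F y \<le> F u" using 2 y zx by (intro mF) auto
        moreover have "q * (u - y) \<le> p * (z - y)" using 2 q p by (intro mult_mono) auto
        moreover have "0 \<le> (p - q) * y" using q y by simp
        ultimately show ?thesis using p by (simp add: d_def algebra_simps)
      next
        case 3
        have "p * (u - z) * (z - y) = (F z - F y) * (u - z)" by (simp flip: p(2))
        also have "\<dots> \<le> (F u - F z) * (z - y)"
          using 3 u zy y S[of y z u] by simp
        finally have "p * (u - z) \<le> F u - F z" using zy by simp
        moreover have "q * (u - y) \<le> p * (u - y)" using 3 zy q by (intro mult_right_mono) auto
        moreover have "0 \<le> (p - q) * y" using q y by simp
        moreover have "p * (u - y) = p * (u - z) + F z - F y" using p(2) by (simp add: algebra_simps)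
        ultimately show ?thesis using YZ by (simp add: d_def algebra_simps)
      qed
    qed
    have d0: "0 \<le> d" using line[of 0] by (simp add: F_def)
    show thesis
    proof (rule *[OF q(1,2) _ _ d0])
      fix u :: real assume u: "0 \<le> u"
      show "ennreal (u * q) \<le> \<phi> (ennreal u) + ennreal d"
      proof (cases "\<phi> (ennreal u) = top")
        case False
        then have "\<phi> (ennreal u) = ennreal (F u)" by (simp add: F_def less_top)
        then show ?thesis using line[OF u] False F0 d0 by (simp add: less_top ennreal_leI flip: ennreal_plus)
      qed simp
    next
      have "q * (x - y) \<ge> 0" using q y by simp
      then show "c' < x * q - d" using q(4) Z \<delta> unfolding d_def \<delta>_def
        by (simp add: algebra_simps)
    qed
  qed
qed

lemma eq_rational_sup:
  assumes "0 \<le> x"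
  shows "\<phi> (ennreal x) = (SUP q\<in>{q\<in>\<rat>. 0 \<le> q}. ennreal q * ennreal x - conj (ennreal q))"
proof (rule antisym)
  show "\<phi> (ennreal x) \<le> (SUP q\<in>{q\<in>\<rat>. 0 \<le> q}. ennreal q * ennreal x - conj (ennreal q))"
  proof (rule dense_le)
    fix c assume "c < \<phi> (ennreal x)"
    then obtain q where "q \<in> \<rat>" "0 \<le> q" "c < ennreal x * ennreal q - conj (ennreal q)"
      by (rule biconjugate)
    then show "c \<le> (SUP q\<in>{q\<in>\<rat>. 0 \<le> q}. ennreal q * ennreal x - conj (ennreal q))"
      by (intro SUP_upper2[of q]) (auto simp: mult.commute)
  qed
  show "(SUP q\<in>{q\<in>\<rat>. 0 \<le> q}. ennreal q * ennreal x - conj (ennreal q)) \<le> \<phi> (ennreal x)"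
    using young[OF assms] assms
    by (auto intro!: SUP_least simp: ennreal_mult_diff_le_iff mult.commute add.commute)
qed


lemma conj_zero [simp]: "conj 0 = 0"
  using conj_le_iff[of 0 0] by simp

text \<open>Equality in Young's inequality says that \<open>x\<close> maximises
  \<open>u * y - \<phi> u\<close>, which is the subgradient inequality with slope \<open>y\<close>
  at \<open>x\<close>. The additive form admits infinite values at \<open>u\<close>, and finiteness
  at \<open>x\<close> permits cancellation.\<close>

lemma young_eq_iff:
  assumes x: "0 \<le> x" and y: "0 \<le> y" and fin: "\<phi> (ennreal x) < top"
  shows "\<phi> (ennreal x) + conj (ennreal y) \<le> ennreal (x * y) \<longleftrightarrow>
    (\<forall>u\<ge>0. \<phi> (ennreal x) + ennreal (u * y) \<le> \<phi> (ennreal u) + ennreal (x * y))" (is "?L \<longleftrightarrow> ?R")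
proof
  assume ?L
  show ?R
  proof (intro allI impI)
    fix u :: real assume "0 \<le> u"
    then have "\<phi> (ennreal x) + ennreal (u * y) \<le> \<phi> (ennreal x) + (\<phi> (ennreal u) + conj (ennreal y))"
      using young y by (intro add_left_mono) auto
    also have "\<dots> = \<phi> (ennreal u) + (\<phi> (ennreal x) + conj (ennreal y))" by (simp add: ac_simps)
    also have "\<dots> \<le> \<phi> (ennreal u) + ennreal (x * y)" using \<open>?L\<close> by (intro add_left_mono)
    finally show "\<phi> (ennreal x) + ennreal (u * y) \<le> \<phi> (ennreal u) + ennreal (x * y)" .
  qed
next
  assume R: ?R
  have le: "\<phi> (ennreal x) \<le> ennreal (x * y)" using R[rule_format, of 0] by simp
  have "conj (ennreal y) \<le> ennreal (x * y) - \<phi> (ennreal x)"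
    unfolding conj_le_iff[OF y]
  proof (intro allI impI)
    fix u :: real assume "0 \<le> u"
    with R have "\<phi> (ennreal x) + ennreal (u * y) \<le> \<phi> (ennreal u) + (\<phi> (ennreal x) + (ennreal (x * y) - \<phi> (ennreal x)))"
      using le by (simp add: add_diff_inverse_ennreal)
    then have "\<phi> (ennreal x) + ennreal (u * y) \<le> \<phi> (ennreal x) + (\<phi> (ennreal u) + (ennreal (x * y) - \<phi> (ennreal x)))"
      by (simp add: ac_simps)
    then show "ennreal (u * y) \<le> \<phi> (ennreal u) + (ennreal (x * y) - \<phi> (ennreal x))"
      using fin by (auto simp: ennreal_add_left_cancel_le)
  qed
  then have "\<phi> (ennreal x) + conj (ennreal y) \<le> \<phi> (ennreal x) + (ennreal (x * y) - \<phi> (ennreal x))"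
    by (rule add_left_mono)
  also have "\<dots> = ennreal (x * y)" using le by (simp add: add_diff_inverse_ennreal)
  finally show ?L .
qed

end

section \<open>One-sided derivatives as subgradient inequalities\<close>

text \<open>Identifies the \<open>Lim\<close> in \<open>left_deriv\<close>: difference quotients of
  a convex function are monotone, so their limit is a supremum and a bound on it is a bound on every
  quotient.\<close>

lemma tendsto_at_left_SUP:
  fixes f :: "ennreal \<Rightarrow> ennreal"
  assumes "0 < a" and mono: "\<And>x y. x \<le> y \<Longrightarrow> y < a \<Longrightarrow> f x \<le> f y"
  shows "(f \<longlongrightarrow> (SUP x\<in>{..<a}. f x)) (at_left a)"
proof (rule order_tendstoI)
  fix l assume "l < (SUP x\<in>{..<a}. f x)"
  then obtain x where "x < a" "l < f x" by (auto simp: less_SUP_iff)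
  then show "eventually (\<lambda>x. l < f x) (at_left a)"
    using assms by (subst eventually_at_left[of 0]) (auto intro!: exI[of _ x] intro: less_le_trans)
next
  fix l assume l: "(SUP x\<in>{..<a}. f x) < l"
  have "f x < l" if "x < a" for x
    using that by (intro le_less_trans[OF SUP_upper l]) auto
  then show "eventually (\<lambda>x. f x < l) (at_left a)"
    using assms by (subst eventually_at_left[of 0]) auto
qed

lemma tendsto_at_right_INF:
  fixes f :: "ennreal \<Rightarrow> ennreal"
  assumes "a < top" and mono: "\<And>x y. a < x \<Longrightarrow> x \<le> y \<Longrightarrow> y < top \<Longrightarrow> f x \<le> f y"
  shows "(f \<longlongrightarrow> (INF x\<in>{a<..<top}. f x)) (at_right a)"
proof (rule order_tendstoI)
  fix l assume "(INF x\<in>{a<..<top}. f x) < l"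
  then obtain x where "a < x" "x < top" "f x < l" by (auto simp: INF_less_iff)
  then show "eventually (\<lambda>x. f x < l) (at_right a)"
    using assms by (subst eventually_at_right[of _ top]) (auto intro!: exI[of _ x] intro: le_less_trans[OF mono[OF _ less_imp_le]])
next
  fix l assume l: "l < (INF x\<in>{a<..<top}. f x)"
  have "l < f x" if "a < x" "x < top" for x
    using that by (intro less_le_trans[OF l INF_lower]) auto
  then show "eventually (\<lambda>x. l < f x) (at_right a)"
    using assms by (subst eventually_at_right[of _ top]) auto
qed

lemma at_left_ennreal_neq_bot:
  assumes "0 < (a::ennreal)" shows "at_left a \<noteq> bot"
proof
  assume "at_left a = bot"
  then have "eventually (\<lambda>_. False) (at_left a)" by simp
  then obtain b where "b < a" "\<And>y. b < y \<Longrightarrow> y < a \<Longrightarrow> False"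
    unfolding eventually_at_left[OF assms] by auto
  then show False using dense by blast
qed

lemma at_right_ennreal_neq_bot:
  assumes "(a::ennreal) < top" shows "at_right a \<noteq> bot"
proof
  assume "at_right a = bot"
  then have "eventually (\<lambda>_. False) (at_right a)" by simp
  then obtain b where "a < b" "\<And>y. a < y \<Longrightarrow> y < b \<Longrightarrow> False"
    unfolding eventually_at_right[OF assms] by auto
  then show False using dense by blast
qed

context
  fixes \<Phi> :: "'a \<Rightarrow> ennreal \<Rightarrow> ennreal" and t :: 'a and x :: real
  assumes Phi: "young_function (\<Phi> t)" and x: "0 \<le> x" and fin: "\<Phi> t (ennreal x) < top"
begin

interpretation young_function "\<Phi> t" by (rule Phi)

lemma left_quotient:
  assumes "0 \<le> w" "w < x"
  shows "(\<Phi> t (ennreal x) - \<Phi> t (ennreal w)) / (ennreal x - ennreal w)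
       = ennreal ((enn2real (\<Phi> t (ennreal x)) - enn2real (\<Phi> t (ennreal w))) / (x - w))"
proof -
  have le: "\<Phi> t (ennreal w) \<le> \<Phi> t (ennreal x)" using assms by (intro mono ennreal_leI) auto
  obtain A B where AB: "\<Phi> t (ennreal x) = ennreal A" "\<Phi> t (ennreal w) = ennreal B" "0 \<le> A" "0 \<le> B"
    using fin le by (cases "\<Phi> t (ennreal x)"; cases "\<Phi> t (ennreal w)") (auto simp: top_unique)
  with le have "B \<le> A" by simp
  then show ?thesis using AB assms by (simp add: ennreal_minus divide_ennreal)
qed

lemma right_quotient:
  assumes "x < w" "\<Phi> t (ennreal w) < top"
  shows "(\<Phi> t (ennreal w) - \<Phi> t (ennreal x)) / (ennreal w - ennreal x)
       = ennreal ((enn2real (\<Phi> t (ennreal w)) - enn2real (\<Phi> t (ennreal x))) / (w - x))"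
proof -
  have le: "\<Phi> t (ennreal x) \<le> \<Phi> t (ennreal w)" using assms by (intro mono ennreal_leI) auto
  obtain A B where AB: "\<Phi> t (ennreal x) = ennreal A" "\<Phi> t (ennreal w) = ennreal B" "0 \<le> A" "0 \<le> B"
    using fin assms(2) by (cases "\<Phi> t (ennreal x)"; cases "\<Phi> t (ennreal w)") (auto simp: top_unique)
  with le have "A \<le> B" by simp
  then show ?thesis using AB assms x by (simp add: ennreal_minus divide_ennreal)
qed

text \<open>The quotients increase with their left endpoint, so the limit is their supremum;
  bounding one quotient by \<open>y\<close> is the subgradient inequality at that point.\<close>

lemma left_deriv_le_iff:
  assumes y: "0 \<le> y"
  shows "left_deriv \<Phi> t (ennreal x) \<le> ennreal y \<longleftrightarrow>
    (\<forall>u\<ge>0. u < x \<longrightarrow> \<Phi> t (ennreal x) + ennreal (u * y) \<le> \<Phi> t (ennreal u) + ennreal (x * y))"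
proof (cases "x = 0")
  case True then show ?thesis by (simp add: left_deriv_def)
next
  case False
  with x have x0: "0 < x" by simp
  let ?Q = "\<lambda>w. (\<Phi> t (ennreal x) - \<Phi> t w) / (ennreal x - w)"
  have real: "{..<ennreal x} = ennreal ` {0..<x}"
  proof (intro set_eqI iffI)
    fix w assume "w \<in> {..<ennreal x}"
    then show "w \<in> ennreal ` {0..<x}" by (cases w) (auto simp: ennreal_less_iff)
  qed (auto simp: ennreal_less_iff)
  have "(?Q \<longlongrightarrow> (SUP w\<in>{..<ennreal x}. ?Q w)) (at_left (ennreal x))"
  proof (rule tendsto_at_left_SUP)
    fix w z assume wz: "w \<le> z" "z < ennreal x"
    then obtain w' z' where *: "w = ennreal w'" "z = ennreal z'" "0 \<le> w'" "w' \<le> z'" "z' < x"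
      by (cases w; cases z) (auto simp: ennreal_less_iff top_unique)
    have F: "enn2real (\<Phi> t (ennreal u)) \<le> enn2real (\<Phi> t (ennreal x))" if "u \<le> x" for u
      using that fin by (intro enn2real_mono mono ennreal_leI)
    show "?Q w \<le> ?Q z"
    proof (cases "w' = z'")
      case False
      have sl: "(enn2real (\<Phi> t (ennreal z')) - enn2real (\<Phi> t (ennreal w'))) * (x - z')
       \<le> (enn2real (\<Phi> t (ennreal x)) - enn2real (\<Phi> t (ennreal z'))) * (z' - w')"
        using slope[of w' z' x] fin * False by simp
      show ?thesis using * sl
        by (simp add: left_quotient frac_le_eq divide_le_eq del: ennreal_le_iff)
           (auto intro!: ennreal_leI simp: field_simps)
    qed (use * in simp)
  qed (use x0 in simp)
  then have "left_deriv \<Phi> t (ennreal x) = (SUP w\<in>{..<ennreal x}. ?Q w)"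
    using x0 less_imp_neq[OF fin] by (simp add: left_deriv_def tendsto_Lim at_left_ennreal_neq_bot)
  also have "\<dots> \<le> ennreal y \<longleftrightarrow> (\<forall>u\<ge>0. u < x \<longrightarrow> ?Q (ennreal u) \<le> ennreal y)"
    by (auto simp: SUP_le_iff real)
  also have "\<dots> \<longleftrightarrow> (\<forall>u\<ge>0. u < x \<longrightarrow> \<Phi> t (ennreal x) + ennreal (u * y) \<le> \<Phi> t (ennreal u) + ennreal (x * y))"
  proof (intro all_cong1 imp_cong refl)
    fix u assume u: "0 \<le> u" "u < x"
    have le: "\<Phi> t (ennreal u) \<le> \<Phi> t (ennreal x)" using u by (intro mono ennreal_leI) auto
    obtain A B where AB: "\<Phi> t (ennreal x) = ennreal A" "\<Phi> t (ennreal u) = ennreal B" "0 \<le> A" "0 \<le> B"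
      using fin le by (cases "\<Phi> t (ennreal x)"; cases "\<Phi> t (ennreal u)") (auto simp: top_unique)
    show "?Q (ennreal u) \<le> ennreal y \<longleftrightarrow> \<Phi> t (ennreal x) + ennreal (u * y) \<le> \<Phi> t (ennreal u) + ennreal (x * y)"
      unfolding left_quotient[OF u] using u y x AB by (simp add: ennreal_le_iff field_simps flip: ennreal_plus)
  qed
  finally show ?thesis .
qed

text \<open>Mirror image of the left case, with an infimum. Where \<Phi> is infinite beyond
  \<open>x\<close>, the quotient is infinite and the subgradient inequality holds trivially, so the
  two sides still agree.\<close>

lemma le_right_deriv_iff:
  assumes y: "0 \<le> y"
  shows "ennreal y \<le> right_deriv \<Phi> t (ennreal x) \<longleftrightarrow>
    (\<forall>u>x. \<Phi> t (ennreal x) + ennreal (u * y) \<le> \<Phi> t (ennreal u) + ennreal (x * y))"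
proof (cases "\<forall>w>ennreal x. \<Phi> t w = top")
  case True
  then have "\<Phi> t (ennreal u) = top" if "x < u" for u
    using that x by (simp add: ennreal_less_iff)
  then show ?thesis using True by (simp add: right_deriv_def)
next
  case False
  let ?Q = "\<lambda>w. (\<Phi> t w - \<Phi> t (ennreal x)) / (w - ennreal x)"
  have real: "{ennreal x<..<top} = ennreal ` {x<..}"
  proof (intro set_eqI iffI)
    fix w assume "w \<in> {ennreal x<..<top}"
    then show "w \<in> ennreal ` {x<..}" using x by (cases w) (auto simp: ennreal_less_iff)
  qed (use x in \<open>auto simp: ennreal_less_iff\<close>)
  have infQ: "?Q (ennreal w) = top" if "x < w" "\<Phi> t (ennreal w) = top" for w
    using that x fin by (simp add: ennreal_top_minus ennreal_top_divide ennreal_minus less_top)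
  have "(?Q \<longlongrightarrow> (INF w\<in>{ennreal x<..<top}. ?Q w)) (at_right (ennreal x))"
  proof (rule tendsto_at_right_INF)
    fix w z assume wz: "ennreal x < w" "w \<le> z" "z < top"
    then obtain w' z' where *: "w = ennreal w'" "z = ennreal z'" "x < w'" "w' \<le> z'" "0 \<le> w'"
      using x by (cases w; cases z) (auto simp: ennreal_less_iff top_unique)
    show "?Q w \<le> ?Q z"
    proof (cases "\<Phi> t z = top \<or> w' = z'")
      case False
      have fin': "\<Phi> t (ennreal z') < top" using False * by (simp add: less_top)
      moreover have "\<Phi> t (ennreal w') \<le> \<Phi> t (ennreal z')" using * by (intro mono ennreal_leI)
      ultimately have fin'': "\<Phi> t (ennreal w') < top" by (rule le_less_trans[rotated])
      have sl: "(enn2real (\<Phi> t (ennreal w')) - enn2real (\<Phi> t (ennreal x))) * (z' - w')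
       \<le> (enn2real (\<Phi> t (ennreal z')) - enn2real (\<Phi> t (ennreal w'))) * (w' - x)"
        using slope[of x w' z'] fin' * False x by simp
      show ?thesis using * sl fin' fin''
        by (simp add: right_quotient del: ennreal_le_iff)
           (auto intro!: ennreal_leI simp: field_simps)
    qed (use * infQ in auto)
  qed simp
  then have "right_deriv \<Phi> t (ennreal x) = (INF w\<in>{ennreal x<..<top}. ?Q w)"
    unfolding right_deriv_def if_not_P[OF False[folded infinity_ennreal_def]]
    by (simp add: tendsto_Lim at_right_ennreal_neq_bot)
  then have "ennreal y \<le> right_deriv \<Phi> t (ennreal x) \<longleftrightarrow> (\<forall>u>x. ennreal y \<le> ?Q (ennreal u))"
    by (auto simp: le_INF_iff real)
  also have "\<dots> \<longleftrightarrow> (\<forall>u>x. \<Phi> t (ennreal x) + ennreal (u * y) \<le> \<Phi> t (ennreal u) + ennreal (x * y))"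
  proof (intro all_cong1 imp_cong refl)
    fix u assume u: "x < u"
    show "ennreal y \<le> ?Q (ennreal u) \<longleftrightarrow> \<Phi> t (ennreal x) + ennreal (u * y) \<le> \<Phi> t (ennreal u) + ennreal (x * y)"
    proof (cases "\<Phi> t (ennreal u) = top")
      case True then show ?thesis using infQ u by simp
    next
      case False
      have le: "\<Phi> t (ennreal x) \<le> \<Phi> t (ennreal u)" using u by (intro mono ennreal_leI) auto
      obtain A B where AB: "\<Phi> t (ennreal x) = ennreal A" "\<Phi> t (ennreal u) = ennreal B" "0 \<le> A" "0 \<le> B"
        using fin False by (cases "\<Phi> t (ennreal x)"; cases "\<Phi> t (ennreal u)") (auto simp: top_unique)
      with le have "A \<le> B" by simp
      then show ?thesis
        unfolding right_quotient[OF u False[unfolded less_top]] using u y x AB by (simp add: ennreal_le_iff field_simps flip: ennreal_plus)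
    qed
  qed
  finally show ?thesis .
qed

text \<open>The two derivative bounds cover \<open>u < x\<close> and \<open>u > x\<close>, and at
  \<open>u = x\<close> the subgradient inequality is an identity. Together they are the equality
  case of Young's inequality.\<close>

lemma mem_subdiff_iff:
  assumes y: "0 \<le> y"
  shows "ennreal y \<in> subdiff \<Phi> t (ennreal x) \<longleftrightarrow>
    \<Phi> t (ennreal x) + compl_fun \<Phi> t (ennreal y) = ennreal (x * y)"
proof -
  have "compl_fun \<Phi> t (ennreal y) = conj (ennreal y)"
    by (simp add: compl_fun_def conj_def)
  then have "\<Phi> t (ennreal x) + compl_fun \<Phi> t (ennreal y) = ennreal (x * y) \<longleftrightarrow>
      \<Phi> t (ennreal x) + conj (ennreal y) \<le> ennreal (x * y)"
    using young[OF x y] by auto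
  also have "\<dots> \<longleftrightarrow> (\<forall>u\<ge>0. u < x \<longrightarrow> \<Phi> t (ennreal x) + ennreal (u * y) \<le> \<Phi> t (ennreal u) + ennreal (x * y)) \<and>
     (\<forall>u>x. \<Phi> t (ennreal x) + ennreal (u * y) \<le> \<Phi> t (ennreal u) + ennreal (x * y))"
    unfolding young_eq_iff[OF x y fin]
  proof (intro iffI conjI allI impI; (elim conjE)?)
    fix u :: real
    assume "0 \<le> u" "\<forall>u\<ge>0. u < x \<longrightarrow> \<Phi> t (ennreal x) + ennreal (u * y) \<le> \<Phi> t (ennreal u) + ennreal (x * y)"
      "\<forall>u>x. \<Phi> t (ennreal x) + ennreal (u * y) \<le> \<Phi> t (ennreal u) + ennreal (x * y)"
    then show "\<Phi> t (ennreal x) + ennreal (u * y) \<le> \<Phi> t (ennreal u) + ennreal (x * y)"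
      by (cases u x rule: linorder_cases) auto
  qed (use x in auto)
  finally show ?thesis by (simp add: subdiff_def left_deriv_le_iff[OF y] le_right_deriv_iff[OF y])
qed

end

subsection \<open>Duality of modulars\<close>

lemma ennreal_add_strict_right_mono: "c < (d::ennreal) \<Longrightarrow> m < top \<Longrightarrow> c + m < d + m"
  by (metis add.commute ennreal_add_left_cancel_less infinity_ennreal_def less_irrefl)

text \<open>Pulls a countable supremum out of the integral. The integrand is a supremum of gains of
  countably many admissible functions, finite maxima of gains are again gains, and monotone
  convergence does the rest. The general \<psi> allows both \<Phi> and its conjugate.\<close>

lemma (in sigma_finite_measure) near_optimal_selection:
  fixes \<psi> :: "'a \<Rightarrow> ennreal \<Rightarrow> ennreal" and w :: "'a \<Rightarrow> real"
  assumes Q: "countable Q" "\<And>q. q \<in> Q \<Longrightarrow> 0 \<le> q"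
    and w [measurable]: "w \<in> borel_measurable M"
    and \<psi>: "\<And>v. v \<in> borel_measurable M \<Longrightarrow> (\<lambda>t. \<psi> t (ennreal \<bar>v t\<bar>)) \<in> borel_measurable M"
    and \<psi>0: "\<And>t. \<psi> t 0 = 0"
    and c: "c < (\<integral>\<^sup>+ t. (SUP q\<in>Q. ennreal q * ennreal \<bar>w t\<bar> - \<psi> t (ennreal q)) \<partial>M)"
  obtains v where "v \<in> borel_measurable M" "\<And>t. 0 \<le> v t" "modular M \<psi> v < top"
    "c + modular M \<psi> v < (\<integral>\<^sup>+ t. ennreal (v t) * ennreal \<bar>w t\<bar> \<partial>M)"
proof -
  define g where "g v t = ennreal (v t) * ennreal \<bar>w t\<bar> - \<psi> t (ennreal (v t))" for v :: "'a \<Rightarrow> real" and t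
  \<comment> \<open>The last condition makes the truncated difference in \<open>g\<close> a genuine
    one, so that the pairing can be recovered as gain plus modular.\<close>
  define ok where "ok v \<longleftrightarrow> v \<in> borel_measurable M \<and> (\<forall>t. 0 \<le> v t) \<and> modular M \<psi> v < top \<and>
    (\<forall>t. \<psi> t (ennreal (v t)) \<le> ennreal (v t) * ennreal \<bar>w t\<bar>)" for v
  have \<psi>ok: "(\<lambda>t. \<psi> t (ennreal (v t))) \<in> borel_measurable M" if "ok v" for v
    using \<psi>[of v] that by (simp add: ok_def)
  have gok [measurable]: "g v \<in> borel_measurable M" if "ok v" for v
  proof -
    have [measurable]: "v \<in> borel_measurable M" using that by (simp add: ok_def)
    note [measurable] = \<psi>ok[OF that]
    show ?thesis unfolding g_def by measurable
  qed
  have modok: "modular M \<psi> v = (\<integral>\<^sup>+ t. \<psi> t (ennreal (v t)) \<partial>M)" if "\<forall>t. 0 \<le> v t" for v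
    using that by (simp add: modular_def)
  have max: "\<exists>v. ok v \<and> (\<forall>t. g v t = max (g v1 t) (g v2 t))" if v: "ok v1" "ok v2" for v1 v2
  proof -
    \<comment> \<open>At each point the candidate with the larger gain is kept; the modular is at
      most the sum of the two and stays finite.\<close>
    define v where "v t = (if g v1 t \<le> g v2 t then v2 t else v1 t)" for t
    note [measurable] = gok[OF v(1)] gok[OF v(2)] \<psi>ok[OF v(1)] \<psi>ok[OF v(2)]
    have v12 [measurable]: "v1 \<in> borel_measurable M" "v2 \<in> borel_measurable M" using v by (auto simp: ok_def)
    have m: "v \<in> borel_measurable M" unfolding v_def by measurable
    have "modular M \<psi> v \<le> (\<integral>\<^sup>+ t. \<psi> t (ennreal (v1 t)) + \<psi> t (ennreal (v2 t)) \<partial>M)"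
      using v by (subst modok) (auto simp: v_def ok_def intro!: nn_integral_mono)
    also have "\<dots> < top" using v by (subst nn_integral_add) (auto simp: ok_def modok)
    finally have "ok v" using m v by (auto simp: ok_def v_def)
    moreover have "g v t = max (g v1 t) (g v2 t)" for t
      by (auto simp: g_def v_def max_def)
    ultimately show ?thesis by blast
  qed
  obtain A :: "nat \<Rightarrow> 'a set" where A: "range A \<subseteq> sets M" "(\<Union>i. A i) = space M" "\<And>i. emeasure M (A i) \<noteq> \<infinity>" "incseq A"
    using sigma_finite_incseq by blast
  have [measurable]: "A i \<in> sets M" for i using A by auto
  \<comment> \<open>The constant \<open>q\<close>, cut down to where it is admissible and to a set
    of finite measure on which its cost is at most \<open>n\<close>. As \<open>n\<close> grows,
    every point with a nonnegative gain from \<open>q\<close> is eventually included.\<close>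
  define e where "e q n t = (if t \<in> A n \<and> \<psi> t (ennreal q) \<le> of_nat n \<and> \<psi> t (ennreal q) \<le> ennreal q * ennreal \<bar>w t\<bar> then q else 0)"
    for q :: real and n t
  have ok_e: "ok (e q n)" if q: "q \<in> Q" for q n
  proof -
    have [measurable]: "(\<lambda>t. \<psi> t (ennreal q)) \<in> borel_measurable M"
      using \<psi>[of "\<lambda>_. q"] Q(2)[OF q] by simp
    have [measurable]: "e q n \<in> borel_measurable M" unfolding e_def by measurable
    have "modular M \<psi> (e q n) \<le> (\<integral>\<^sup>+ t. of_nat n * indicator (A n) t \<partial>M)"
      using Q(2)[OF q] by (subst modok) (auto simp: e_def \<psi>0 intro!: nn_integral_mono)
    also have "\<dots> < top"
      using A(3)[of n] by (simp add: nn_integral_cmult_indicator ennreal_mult_less_top less_top of_nat_less_top)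
    finally have "modular M \<psi> (e q n) < top" .
    moreover have "0 \<le> e q n t" "\<psi> t (ennreal (e q n t)) \<le> ennreal (e q n t) * ennreal \<bar>w t\<bar>" for t
      using Q(2)[OF q] by (auto simp: e_def \<psi>0)
    moreover have "e q n \<in> borel_measurable M" by measurable
    ultimately show ?thesis by (simp add: ok_def)
  qed
  have F: "(SUP q\<in>Q. ennreal q * ennreal \<bar>w t\<bar> - \<psi> t (ennreal q)) = (SUP i\<in>Q \<times> UNIV. g (e (fst i) (snd i)) t)"
    if t: "t \<in> space M" for t
  proof (rule antisym)
    show "(SUP q\<in>Q. ennreal q * ennreal \<bar>w t\<bar> - \<psi> t (ennreal q)) \<le> (SUP i\<in>Q \<times> UNIV. g (e (fst i) (snd i)) t)"
    proof (rule SUP_least)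
      fix q assume q: "q \<in> Q"
      show "ennreal q * ennreal \<bar>w t\<bar> - \<psi> t (ennreal q) \<le> (SUP i\<in>Q \<times> UNIV. g (e (fst i) (snd i)) t)"
      proof (cases "\<psi> t (ennreal q) \<le> ennreal q * ennreal \<bar>w t\<bar>")
        case True
        also have "ennreal q * ennreal \<bar>w t\<bar> < top" by (simp add: ennreal_mult_less_top)
        finally obtain n1 :: nat where n1: "\<psi> t (ennreal q) < of_nat n1"
          using ennreal_Ex_less_of_nat by blast
        obtain n2 where n2: "t \<in> A n2" using A(2) t by blast
        have "t \<in> A (max n1 n2)" using incseqD[OF A(4), of n2 "max n1 n2"] n2 by auto
        moreover have "\<psi> t (ennreal q) \<le> of_nat (max n1 n2)"
          by (rule order.trans[OF less_imp_le[OF n1] of_nat_mono]) simp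
        ultimately have "e q (max n1 n2) t = q"
          unfolding e_def using True by (intro if_P conjI)
        then have "g (e q (max n1 n2)) t = ennreal q * ennreal \<bar>w t\<bar> - \<psi> t (ennreal q)"
          by (simp add: g_def)
        then show ?thesis using q by (intro SUP_upper2[of "(q, max n1 n2)"]) auto
      next
        case False
        then have "ennreal q * ennreal \<bar>w t\<bar> - \<psi> t (ennreal q) = 0"
          by (intro diff_eq_0_ennreal) (auto simp: ennreal_mult_less_top)
        then show ?thesis by simp
      qed
    qed
    show "(SUP i\<in>Q \<times> UNIV. g (e (fst i) (snd i)) t) \<le> (SUP q\<in>Q. ennreal q * ennreal \<bar>w t\<bar> - \<psi> t (ennreal q))"
    proof (rule SUP_least)
      fix i :: "real \<times> nat" assume i: "i \<in> Q \<times> UNIV"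
      have "g (e (fst i) (snd i)) t \<le> ennreal (fst i) * ennreal \<bar>w t\<bar> - \<psi> t (ennreal (fst i))"
        by (auto simp: g_def e_def \<psi>0)
      with i show "g (e (fst i) (snd i)) t \<le> (SUP q\<in>Q. ennreal q * ennreal \<bar>w t\<bar> - \<psi> t (ennreal q))"
        by (intro SUP_upper2[of "fst i"]) auto
    qed
  qed
  have "Q \<noteq> {}" using c by (auto simp: bot_ennreal)
  define E where "E k = (case from_nat_into (Q \<times> (UNIV::nat set)) k of (q, n) \<Rightarrow> e q n)" for k
  have ran: "range (from_nat_into (Q \<times> (UNIV::nat set))) = Q \<times> UNIV"
    using Q(1) \<open>Q \<noteq> {}\<close> by (intro range_from_nat_into countable_SIGMA) simp_all
  have okE: "ok (E k)" for k
  proof -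
    have "from_nat_into (Q \<times> (UNIV::nat set)) k \<in> Q \<times> UNIV" by (subst ran[symmetric]) (rule rangeI)
    then show ?thesis using ok_e by (auto simp: E_def)
  qed
  have F': "(SUP q\<in>Q. ennreal q * ennreal \<bar>w t\<bar> - \<psi> t (ennreal q)) = (SUP k. g (E k) t)" if "t \<in> space M" for t
    by (subst F[OF that], subst ran[symmetric]) (simp add: image_image E_def case_prod_beta)
  have "\<exists>v. ok v \<and> (\<forall>t. g v t = (SUP k\<in>{..n}. g (E k) t))" for n
  proof (induction n)
    case 0 show ?case using okE[of 0] by auto
  next
    case (Suc n)
    then obtain v where v: "ok v" "\<And>t. g v t = (SUP k\<in>{..n}. g (E k) t)" by blast
    from max[OF v(1) okE[of "Suc n"]] show ?case
      by (simp add: v(2) atMost_Suc sup_max[symmetric] sup.commute)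
  qed
  then have "\<forall>n. \<exists>v. ok v \<and> (\<forall>t. g v t = (SUP k\<in>{..n}. g (E k) t))" by blast
  then obtain W where "\<forall>n. ok (W n) \<and> (\<forall>t. g (W n) t = (SUP k\<in>{..n}. g (E k) t))"
    by (rule exE[OF choice])
  then have W: "\<And>n. ok (W n)" "\<And>n t. g (W n) t = (SUP k\<in>{..n}. g (E k) t)" by blast+
  have inc: "incseq (\<lambda>n. g (W n))"
    by (auto simp: incseq_def le_fun_def W(2) intro!: SUP_subset_mono)
  have "(SUP k. g (E k) t) = (SUP n. g (W n) t)" for t
    unfolding W(2) by (intro antisym SUP_least) (auto intro: SUP_upper2)
  then have "(\<integral>\<^sup>+ t. (SUP q\<in>Q. ennreal q * ennreal \<bar>w t\<bar> - \<psi> t (ennreal q)) \<partial>M) = (\<integral>\<^sup>+ t. (SUP n. g (W n) t) \<partial>M)"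
    by (intro nn_integral_cong) (simp add: F')
  also have "\<dots> = (SUP n. \<integral>\<^sup>+ t. g (W n) t \<partial>M)"
    using inc W(1) by (intro nn_integral_monotone_convergence_SUP) auto
  finally obtain n where n: "c < (\<integral>\<^sup>+ t. g (W n) t \<partial>M)" using c by (auto simp: less_SUP_iff)
  note ok = W(1)[of n, unfolded ok_def]
  note [measurable] = \<psi>ok[OF W(1), of n] gok[OF W(1), of n]
  have "(\<integral>\<^sup>+ t. ennreal (W n t) * ennreal \<bar>w t\<bar> \<partial>M) = (\<integral>\<^sup>+ t. g (W n) t + \<psi> t (ennreal (W n t)) \<partial>M)"
    using ok by (intro nn_integral_cong) (simp add: g_def diff_add_cancel_ennreal)
  also have "\<dots> = (\<integral>\<^sup>+ t. g (W n) t \<partial>M) + modular M \<psi> (W n)"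
    using ok by (simp add: modok nn_integral_add)
  finally have final: "c + modular M \<psi> (W n) < (\<integral>\<^sup>+ t. ennreal (W n t) * ennreal \<bar>w t\<bar> \<partial>M)"
    using n ok by (simp add: ennreal_add_strict_right_mono)
  show thesis
  proof (rule that)
    show "W n \<in> borel_measurable M" "modular M \<psi> (W n) < top" using ok by blast+
    show "0 \<le> W n t" for t using ok by blast
    show "c + modular M \<psi> (W n) < (\<integral>\<^sup>+ t. ennreal (W n t) * ennreal \<bar>w t\<bar> \<partial>M)" by (rule final)
  qed
qed

text \<open>Every section is a Young function, not merely almost every one;
  \<open>everywhere_version\<close> reduces the theorem to this case.\<close>

locale mo_setting = sigma_finite_measure M for M :: "'a measure" +
  fixes \<Phi> :: "'a \<Rightarrow> ennreal \<Rightarrow> ennreal"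
  assumes young_function: "young_function (\<Phi> t)"
    and measurable_section: "0 \<le> x \<Longrightarrow> (\<lambda>t. \<Phi> t (ennreal x)) \<in> borel_measurable M"
begin

abbreviation "I \<equiv> modular M \<Phi>"
abbreviation "J \<equiv> modular M (compl_fun \<Phi>)"
abbreviation "L \<equiv> mo_space M \<Phi>"
abbreviation "N \<equiv> orlicz_norm M \<Phi>"

lemma compl_fun_eq: "compl_fun \<Phi> t = young_function.conj (\<Phi> t)"
  by (simp add: fun_eq_iff compl_fun_def young_function.conj_def[OF young_function])

lemma Phi_zero [simp]: "\<Phi> t 0 = 0"
  by (rule young_function.zero[OF young_function])

lemma compl_zero [simp]: "compl_fun \<Phi> t 0 = 0"
  by (simp add: compl_fun_eq young_function.conj_zero[OF young_function])

lemma Phi_mono: "x \<le> y \<Longrightarrow> \<Phi> t x \<le> \<Phi> t y"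
  by (rule young_function.mono[OF young_function])

lemma young: "0 \<le> x \<Longrightarrow> 0 \<le> y \<Longrightarrow> ennreal (x * y) \<le> \<Phi> t (ennreal x) + compl_fun \<Phi> t (ennreal y)"
  by (simp add: compl_fun_eq young_function.young[OF young_function])

text \<open>The conjugate is a supremum of functions affine in its argument. Mixing the Young
  inequalities for \<open>x\<close> and \<open>y\<close> at the same \<open>u\<close> is this
  argument without subtraction.\<close>

lemma compl_convex:
  assumes "0 \<le> x" "0 \<le> y" "0 \<le> \<theta>" "\<theta> \<le> 1"
  shows "compl_fun \<Phi> t (ennreal (\<theta> * x + (1 - \<theta>) * y))
    \<le> ennreal \<theta> * compl_fun \<Phi> t (ennreal x) + ennreal (1 - \<theta>) * compl_fun \<Phi> t (ennreal y)"
  unfolding compl_fun_eq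
proof (subst young_function.conj_le_iff[OF young_function], use assms in simp, intro allI impI, fold compl_fun_eq)
  fix u :: real assume u: "0 \<le> u"
  have 1: "ennreal \<theta> + ennreal (1 - \<theta>) = 1" using assms by (simp flip: ennreal_plus)
  have "ennreal (u * (\<theta> * x + (1 - \<theta>) * y)) = ennreal \<theta> * ennreal (u * x) + ennreal (1 - \<theta>) * ennreal (u * y)"
  proof -
    have "u * (\<theta> * x + (1 - \<theta>) * y) = \<theta> * (u * x) + (1 - \<theta>) * (u * y)" by (simp add: algebra_simps)
    then show ?thesis using assms u by (simp add: ennreal_mult)
  qed
  also have "\<dots> \<le> ennreal \<theta> * (\<Phi> t (ennreal u) + compl_fun \<Phi> t (ennreal x)) + ennreal (1 - \<theta>) * (\<Phi> t (ennreal u) + compl_fun \<Phi> t (ennreal y))"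
    using young u assms by (intro add_mono mult_left_mono) auto
  also have "\<dots> = (ennreal \<theta> + ennreal (1 - \<theta>)) * \<Phi> t (ennreal u) + (ennreal \<theta> * compl_fun \<Phi> t (ennreal x) + ennreal (1 - \<theta>) * compl_fun \<Phi> t (ennreal y))"
    by (simp only: distrib_left distrib_right ac_simps)
  finally show "ennreal (u * (\<theta> * x + (1 - \<theta>) * y)) \<le> \<Phi> t (ennreal u) + (ennreal \<theta> * compl_fun \<Phi> t (ennreal x) + ennreal (1 - \<theta>) * compl_fun \<Phi> t (ennreal y))"
    by (simp add: 1)
qed

lemma countable_nonneg_rats: "countable {q\<in>\<rat>. 0 \<le> (q::real)}"
  by (rule countable_subset[OF _ countable_rat]) auto

text \<open>Sections are measurable for constant arguments only. Left continuity writes the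
  composition as a supremum over rationals below the argument.\<close>

lemma measurable_Phi [measurable]:
  assumes [measurable]: "u \<in> borel_measurable M"
  shows "(\<lambda>t. \<Phi> t (ennreal \<bar>u t\<bar>)) \<in> borel_measurable M"
proof -
  have "\<Phi> t (ennreal \<bar>u t\<bar>) = (SUP q\<in>{q\<in>\<rat>. 0 \<le> q}. if q < \<bar>u t\<bar> then \<Phi> t (ennreal q) else 0)" for t
  proof (rule antisym)
    show "\<Phi> t (ennreal \<bar>u t\<bar>) \<le> (SUP q\<in>{q\<in>\<rat>. 0 \<le> q}. if q < \<bar>u t\<bar> then \<Phi> t (ennreal q) else 0)"
    proof (rule dense_le)
      fix c assume "c < \<Phi> t (ennreal \<bar>u t\<bar>)"
      then obtain q where "q \<in> \<rat>" "0 \<le> q" "q < \<bar>u t\<bar>" "c < \<Phi> t (ennreal q)"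
        by (rule young_function.rational_below[OF young_function])
      then show "c \<le> (SUP q\<in>{q\<in>\<rat>. 0 \<le> q}. if q < \<bar>u t\<bar> then \<Phi> t (ennreal q) else 0)"
        by (intro SUP_upper2[of q]) auto
    qed
    show "(SUP q\<in>{q\<in>\<rat>. 0 \<le> q}. if q < \<bar>u t\<bar> then \<Phi> t (ennreal q) else 0) \<le> \<Phi> t (ennreal \<bar>u t\<bar>)"
      by (rule SUP_least) (auto intro!: Phi_mono ennreal_leI)
  qed
  moreover have "(\<lambda>t. SUP q\<in>{q\<in>\<rat>. 0 \<le> q}. if q < \<bar>u t\<bar> then \<Phi> t (ennreal q) else 0) \<in> borel_measurable M"
  proof (rule borel_measurable_SUP[OF countable_nonneg_rats])
    fix q :: real assume "q \<in> {q\<in>\<rat>. 0 \<le> q}"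
    then have [measurable]: "(\<lambda>t. \<Phi> t (ennreal q)) \<in> borel_measurable M" by (simp add: measurable_section)
    show "(\<lambda>t. if q < \<bar>u t\<bar> then \<Phi> t (ennreal q) else 0) \<in> borel_measurable M" by measurable
  qed
  ultimately show ?thesis by presburger
qed

lemma compl_rational_sup: "0 \<le> y \<Longrightarrow>
  compl_fun \<Phi> t (ennreal y) = (SUP q\<in>{q\<in>\<rat>. 0 \<le> q}. ennreal q * ennreal y - \<Phi> t (ennreal q))"
  unfolding compl_fun_eq by (rule young_function.conj_eq_rational_sup[OF young_function])

lemma Phi_rational_sup: "0 \<le> x \<Longrightarrow>
  \<Phi> t (ennreal x) = (SUP q\<in>{q\<in>\<rat>. 0 \<le> q}. ennreal q * ennreal x - compl_fun \<Phi> t (ennreal q))"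
  unfolding compl_fun_eq by (rule young_function.eq_rational_sup[OF young_function])

lemma measurable_compl [measurable]:
  assumes [measurable]: "v \<in> borel_measurable M"
  shows "(\<lambda>t. compl_fun \<Phi> t (ennreal \<bar>v t\<bar>)) \<in> borel_measurable M"
proof -
  have "(\<lambda>t. SUP q\<in>{q\<in>\<rat>. 0 \<le> q}. ennreal q * ennreal \<bar>v t\<bar> - \<Phi> t (ennreal q)) \<in> borel_measurable M"
  proof (rule borel_measurable_SUP[OF countable_nonneg_rats])
    fix q :: real assume "q \<in> {q\<in>\<rat>. 0 \<le> q}"
    then have [measurable]: "(\<lambda>t. \<Phi> t (ennreal q)) \<in> borel_measurable M" by (simp add: measurable_section)
    show "(\<lambda>t. ennreal q * ennreal \<bar>v t\<bar> - \<Phi> t (ennreal q)) \<in> borel_measurable M" by measurable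
  qed
  then show ?thesis by (simp add: compl_rational_sup)
qed

text \<open>The modular \<open>I\<close> is the conjugate of \<open>J\<close>. Pointwise
  biconjugation enters through \<open>Phi_rational_sup\<close>; this drives the hard half of the
  Amemiya formula.\<close>

lemma modular_dual_approx:
  assumes w: "w \<in> borel_measurable M" and c: "c < I w"
  obtains v where "v \<in> borel_measurable M" "\<And>t. 0 \<le> v t" "J v < top"
    "c + J v < (\<integral>\<^sup>+ t. ennreal (v t) * ennreal \<bar>w t\<bar> \<partial>M)"
proof (rule near_optimal_selection[OF countable_nonneg_rats _ w, of "compl_fun \<Phi>" c])
  have "I w = (\<integral>\<^sup>+ t. (SUP q\<in>{q\<in>\<rat>. 0 \<le> q}. ennreal q * ennreal \<bar>w t\<bar> - compl_fun \<Phi> t (ennreal q)) \<partial>M)"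
    unfolding modular_def by (intro nn_integral_cong Phi_rational_sup) simp
  with c show "c < (\<integral>\<^sup>+ t. (SUP q\<in>{q\<in>\<rat>. 0 \<le> q}. ennreal q * ennreal \<bar>w t\<bar> - compl_fun \<Phi> t (ennreal q)) \<partial>M)"
    by simp
qed (use that measurable_compl in auto)

text \<open>The converse duality, which later turns a bound on all pairings with \<open>v\<close>
  into a bound on \<open>J v\<close>.\<close>

lemma compl_modular_approx:
  assumes v: "v \<in> borel_measurable M" and c: "c < J v"
  obtains w where "w \<in> borel_measurable M" "\<And>t. 0 \<le> w t" "I w < top"
    "c + I w < (\<integral>\<^sup>+ t. ennreal (w t) * ennreal \<bar>v t\<bar> \<partial>M)"
proof (rule near_optimal_selection[OF countable_nonneg_rats _ v, of \<Phi> c])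
  have "J v = (\<integral>\<^sup>+ t. (SUP q\<in>{q\<in>\<rat>. 0 \<le> q}. ennreal q * ennreal \<bar>v t\<bar> - \<Phi> t (ennreal q)) \<partial>M)"
    unfolding modular_def by (intro nn_integral_cong compl_rational_sup) simp
  with c show "c < (\<integral>\<^sup>+ t. (SUP q\<in>{q\<in>\<rat>. 0 \<le> q}. ennreal q * ennreal \<bar>v t\<bar> - \<Phi> t (ennreal q)) \<partial>M)"
    by simp
qed (use that measurable_Phi in auto)

end

subsection \<open>The Orlicz norm and the Amemiya norm\<close>

text \<open>The supremum of \<open>(a - H) / (b - 1)\<close> over \<open>b > 1\<close> is a Lagrange multiplier for maximising
  \<open>a\<close> under the constraint \<open>b \<le> 1\<close>.\<close>

lemma lagrange_multiplier:
  fixes P :: "(real \<times> real) set" and H :: real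
  assumes mix: "\<And>a1 b1 a2 b2 \<theta>. (a1, b1) \<in> P \<Longrightarrow> (a2, b2) \<in> P \<Longrightarrow> 0 \<le> \<theta> \<Longrightarrow> \<theta> \<le> 1 \<Longrightarrow>
      \<theta> * b1 + (1 - \<theta>) * b2 \<le> 1 \<Longrightarrow> \<theta> * a1 + (1 - \<theta>) * a2 \<le> H"
    and zero: "(0, 0) \<in> P"
  shows "\<exists>l\<ge>0. \<forall>a b. (a, b) \<in> P \<longrightarrow> a \<le> H + l * (b - 1)"
proof -
  \<comment> \<open>Inserting 0 makes the multiplier nonnegative and the set nonempty even if no
    pair violates the constraint.\<close>
  define S where "S = insert 0 {(a - H) / (b - 1) | a b. (a, b) \<in> P \<and> 1 < b}"
  have le: "a \<le> H" if "(a, b) \<in> P" "b \<le> 1" for a b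
    using mix[OF that(1) that(1), of 1] that by simp
  have bound: "x \<le> (H - a2) / (1 - b2)" if "x \<in> S" "(a2, b2) \<in> P" "b2 < 1" for x a2 b2
  proof (cases "x = 0")
    case True then show ?thesis using le[of a2 b2] that by simp
  next
    case False
    then obtain a1 b1 where x: "x = (a1 - H) / (b1 - 1)" "(a1, b1) \<in> P" "1 < b1" using \<open>x \<in> S\<close> by (auto simp: S_def)
    \<comment> \<open>The mixture for which the constraint is exactly tight.\<close>
    define \<theta> where "\<theta> = (1 - b2) / (b1 - b2)"
    have \<theta>: "0 \<le> \<theta>" "\<theta> \<le> 1" using x that by (auto simp: \<theta>_def)
    have \<theta>b: "\<theta> * (b1 - b2) = 1 - b2" using x that by (simp add: \<theta>_def)
    have "\<theta> * a1 + (1 - \<theta>) * a2 \<le> H"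
      using x that \<theta> \<theta>b by (intro mix[of _ b1 _ b2]) (auto simp: algebra_simps)
    then have "(\<theta> * a1 + (1 - \<theta>) * a2) * (b1 - b2) \<le> H * (b1 - b2)"
      using x that by (intro mult_right_mono) auto
    also have "(\<theta> * a1 + (1 - \<theta>) * a2) * (b1 - b2) = (\<theta> * (b1 - b2)) * (a1 - a2) + a2 * (b1 - b2)"
      by (simp add: algebra_simps)
    finally have "(1 - b2) * (a1 - a2) + a2 * (b1 - b2) \<le> H * (b1 - b2)" by (simp add: \<theta>b)
    then have "(a1 - H) * (1 - b2) \<le> (H - a2) * (b1 - 1)" by (simp add: algebra_simps)
    then show ?thesis unfolding x(1) using x(3) that(3) by (simp add: pos_divide_le_eq pos_le_divide_eq mult.commute)
  qed
  \<comment> \<open>The origin is a strictly feasible point, as in Slater's condition, and bounds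
    all slopes by \<open>H\<close>.\<close>
  have bdd: "bdd_above S" using bound[OF _ zero] by (auto intro!: bdd_aboveI)
  show ?thesis
  proof (intro exI[of _ "Sup S"] conjI allI impI)
    show "0 \<le> Sup S" by (rule cSup_upper[OF _ bdd]) (simp add: S_def)
    fix a b assume ab: "(a, b) \<in> P"
    consider "b = 1" | "1 < b" | "b < 1" by linarith
    then show "a \<le> H + Sup S * (b - 1)"
    proof cases
      case 2
      then have "(a - H) / (b - 1) \<le> Sup S" using ab by (intro cSup_upper bdd) (auto simp: S_def)
      then show ?thesis using 2 by (simp add: field_simps)
    next
      case 3
      then have "Sup S \<le> (H - a) / (1 - b)" using ab bound by (intro cSup_least) (auto simp: S_def)
      then show ?thesis using 3 by (simp add: field_simps)
    qed (use le ab in simp)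
  qed
qed

lemma le_divide_ennreal_iff: "0 < k \<Longrightarrow> x \<le> y / ennreal k \<longleftrightarrow> ennreal k * x \<le> y"
  using divide_less_ennreal[of "ennreal k" y x] by (simp add: linorder_not_less[symmetric] mult.commute)

context mo_setting
begin

lemma I_mono: "AE t in M. \<bar>w t\<bar> \<le> \<bar>z t\<bar> \<Longrightarrow> I w \<le> I z"
  unfolding modular_def by (intro nn_integral_mono_AE) (auto elim!: eventually_mono intro!: Phi_mono ennreal_leI)

text \<open>The mean is pointwise at most the larger of the two absolute values, so monotonicity
  suffices.\<close>

lemma I_add_half:
  assumes "w \<in> borel_measurable M" "z \<in> borel_measurable M"
  shows "I (\<lambda>t. (w t + z t) / 2) \<le> I w + I z"
proof -
  note [measurable] = measurable_Phi[OF assms(1)] measurable_Phi[OF assms(2)]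
  have "\<Phi> t (ennreal \<bar>(w t + z t) / 2\<bar>) \<le> \<Phi> t (ennreal \<bar>w t\<bar>) + \<Phi> t (ennreal \<bar>z t\<bar>)" for t
  proof (cases "\<bar>w t\<bar> \<le> \<bar>z t\<bar>")
    case True
    then have "\<Phi> t (ennreal \<bar>(w t + z t) / 2\<bar>) \<le> \<Phi> t (ennreal \<bar>z t\<bar>)" by (intro Phi_mono ennreal_leI) auto
    then show ?thesis by (simp add: add_increasing)
  next
    case False
    then have "\<Phi> t (ennreal \<bar>(w t + z t) / 2\<bar>) \<le> \<Phi> t (ennreal \<bar>w t\<bar>)" by (intro Phi_mono ennreal_leI) auto
    then show ?thesis by (simp add: add_increasing2)
  qed
  then have "I (\<lambda>t. (w t + z t) / 2) \<le> (\<integral>\<^sup>+ t. \<Phi> t (ennreal \<bar>w t\<bar>) + \<Phi> t (ennreal \<bar>z t\<bar>) \<partial>M)"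
    unfolding modular_def by (intro nn_integral_mono)
  also have "\<dots> = I w + I z" by (simp add: modular_def nn_integral_add)
  finally show ?thesis .
qed

lemma I_zero [simp]: "I (\<lambda>t. 0) = 0" by (simp add: modular_def)

lemma L_measurable: "w \<in> L \<Longrightarrow> w \<in> borel_measurable M" by (simp add: mo_space_def)

lemma L_I: "w \<in> borel_measurable M \<Longrightarrow> I w < top \<Longrightarrow> w \<in> L"
  by (auto simp: mo_space_def intro!: exI[of _ 1])

lemma L_solid:
  assumes "w \<in> L" "z \<in> borel_measurable M" "AE t in M. \<bar>z t\<bar> \<le> \<bar>w t\<bar>"
  shows "z \<in> L"
proof -
  obtain c where c: "c > 0" "I (\<lambda>t. c * w t) < top" using assms by (auto simp: mo_space_def)
  have "I (\<lambda>t. c * z t) \<le> I (\<lambda>t. c * w t)"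
    using assms(3) c by (intro I_mono) (auto simp: abs_mult)
  with c assms(2) show ?thesis by (auto simp: mo_space_def intro!: exI[of _ c])
qed

lemma L_scale: assumes "w \<in> L" shows "(\<lambda>t. c * w t) \<in> L"
proof (cases "c = 0")
  case True then show ?thesis by (auto intro!: L_I)
next
  case False
  obtain k where k: "k > 0" "I (\<lambda>t. k * w t) < top" using assms by (auto simp: mo_space_def)
  have "I (\<lambda>t. (k / \<bar>c\<bar>) * (c * w t)) \<le> I (\<lambda>t. k * w t)"
    using False k by (intro I_mono) (auto simp: abs_mult)
  with k False assms show ?thesis by (auto simp: mo_space_def intro!: exI[of _ "k / \<bar>c\<bar>"] borel_measurable_times)
qed

lemma L_add: assumes "w \<in> L" "z \<in> L" shows "(\<lambda>t. w t + z t) \<in> L"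
proof -
  obtain c d where c: "c > 0" "I (\<lambda>t. c * w t) < top" and d: "d > 0" "I (\<lambda>t. d * z t) < top"
    using assms by (auto simp: mo_space_def)
  define e where "e = min c d"
  have e: "e > 0" using c d by (simp add: e_def)
  note [measurable] = L_measurable[OF assms(1)] L_measurable[OF assms(2)]
  have "I (\<lambda>t. (e / 2) * (w t + z t)) = I (\<lambda>t. (e * w t + e * z t) / 2)" by (simp add: algebra_simps)
  also have "\<dots> \<le> I (\<lambda>t. e * w t) + I (\<lambda>t. e * z t)" by (rule I_add_half) auto
  also have "\<dots> \<le> I (\<lambda>t. c * w t) + I (\<lambda>t. d * z t)"
    using c d by (intro add_mono I_mono) (auto simp: abs_mult e_def intro!: mult_right_mono)
  also have "\<dots> < top" using c d by simp
  finally show ?thesis using e by (auto simp: mo_space_def intro!: exI[of _ "e / 2"])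
qed

lemma L_diff: "w \<in> L \<Longrightarrow> z \<in> L \<Longrightarrow> (\<lambda>t. w t - z t) \<in> L"
  using L_add[OF _ L_scale[of z "-1"]] by simp

lemma L_abs: "w \<in> L \<Longrightarrow> (\<lambda>t. \<bar>w t\<bar>) \<in> L"
  by (rule L_solid) (auto dest: L_measurable)

lemma young_integral:
  assumes [measurable]: "w \<in> borel_measurable M" "v \<in> borel_measurable M"
  shows "(\<integral>\<^sup>+ t. ennreal \<bar>w t * v t\<bar> \<partial>M) \<le> I w + J v"
proof -
  note [measurable] = measurable_Phi[OF assms(1)] measurable_compl[OF assms(2)]
  have "(\<integral>\<^sup>+ t. ennreal \<bar>w t * v t\<bar> \<partial>M) \<le> (\<integral>\<^sup>+ t. \<Phi> t (ennreal \<bar>w t\<bar>) + compl_fun \<Phi> t (ennreal \<bar>v t\<bar>) \<partial>M)"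
    by (intro nn_integral_mono) (simp add: abs_mult young)
  also have "\<dots> = I w + J v" by (simp add: modular_def nn_integral_add)
  finally show ?thesis .
qed

lemma product_finite:
  assumes "w \<in> L" "v \<in> mo_space M (compl_fun \<Phi>)"
  shows "(\<integral>\<^sup>+ t. ennreal \<bar>w t * v t\<bar> \<partial>M) < top"
proof -
  obtain c d where c: "c > 0" "I (\<lambda>t. c * w t) < top" and d: "d > 0" "J (\<lambda>t. d * v t) < top"
    and [measurable]: "w \<in> borel_measurable M" "v \<in> borel_measurable M"
    using assms by (auto simp: mo_space_def)
  have "ennreal (c * d) * (\<integral>\<^sup>+ t. ennreal \<bar>w t * v t\<bar> \<partial>M) = (\<integral>\<^sup>+ t. ennreal \<bar>(c * w t) * (d * v t)\<bar> \<partial>M)"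
    using c(1) d(1) by (subst nn_integral_cmult[symmetric]) (auto simp: abs_mult ac_simps simp flip: ennreal_mult)
  also have "\<dots> \<le> I (\<lambda>t. c * w t) + J (\<lambda>t. d * v t)" by (rule young_integral) auto
  also have "\<dots> < top" using c d by simp
  finally show ?thesis using c d by (auto simp: ennreal_mult_less_top)
qed

lemma product_integrable:
  assumes "w \<in> L" "v \<in> mo_space M (compl_fun \<Phi>)"
  shows "integrable M (\<lambda>t. w t * v t)"
  using product_finite[OF assms] assms by (auto simp: integrable_iff_bounded mo_space_def)

lemma mo_class_subset: "v \<in> mo_class M (compl_fun \<Phi>) \<Longrightarrow> v \<in> mo_space M (compl_fun \<Phi>)"
  by (auto simp: mo_class_def mo_space_def intro!: exI[of _ 1])

abbreviation "dual_ball \<equiv> {v \<in> mo_class M (compl_fun \<Phi>). J v \<le> 1}"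

lemma zero_in_dual_ball: "(\<lambda>t. 0) \<in> dual_ball"
  by (simp add: mo_class_def modular_def)

text \<open>The easy half of the Amemiya formula: Young's inequality for \<open>k * w\<close> and
  \<open>v\<close>, divided by \<open>k\<close>.\<close>

lemma pairing_le_amemiya:
  assumes w: "w \<in> borel_measurable M" and v: "v \<in> borel_measurable M" "J v \<le> 1" and k: "k > 0"
  shows "ennreal \<bar>LINT t|M. w t * v t\<bar> \<le> amemiya M \<Phi> w k"
proof -
  note [measurable] = w v(1)
  have "ennreal k * ennreal \<bar>LINT t|M. w t * v t\<bar> \<le> ennreal k * (\<integral>\<^sup>+ t. ennreal \<bar>w t * v t\<bar> \<partial>M)"
  proof (cases "integrable M (\<lambda>t. w t * v t)")
    case True
    then show ?thesis using integral_norm_bound_ennreal[OF True] by (intro mult_left_mono) auto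
  \<comment> \<open>The Bochner integral of a non-integrable function is 0 by convention.\<close>
  qed (simp add: not_integrable_integral_eq)
  also have "\<dots> = (\<integral>\<^sup>+ t. ennreal \<bar>(k * w t) * v t\<bar> \<partial>M)"
    using k by (subst nn_integral_cmult[symmetric]) (auto simp: abs_mult ac_simps simp flip: ennreal_mult)
  also have "\<dots> \<le> I (\<lambda>t. k * w t) + J v" by (rule young_integral) auto
  also have "\<dots> \<le> 1 + I (\<lambda>t. k * w t)" using v by (simp add: add.commute add_left_mono)
  finally show ?thesis using k by (simp add: amemiya_def le_divide_ennreal_iff)
qed

lemma amemiya_finite:
  assumes "w \<in> L" shows "\<exists>k>0. amemiya M \<Phi> w k < top"
proof -
  obtain c where c: "c > 0" "I (\<lambda>t. c * w t) < top" using assms by (auto simp: mo_space_def)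
  then have "amemiya M \<Phi> w c < top"
    unfolding amemiya_def by (simp add: divide_less_ennreal ennreal_top_mult)
  with c show ?thesis by blast
qed

text \<open>\<open>orlicz_norm\<close> is a supremum of reals and is meaningful only over a bounded
  set; any finite Amemiya value is a bound.\<close>

lemma bdd_pairing:
  assumes "w \<in> L" shows "bdd_above ((\<lambda>v. \<bar>LINT t|M. w t * v t\<bar>) ` dual_ball)"
proof -
  obtain k where k: "k > 0" "amemiya M \<Phi> w k < top" using amemiya_finite[OF assms] by blast
  then obtain r where r: "amemiya M \<Phi> w k = ennreal r" "0 \<le> r" by (cases "amemiya M \<Phi> w k") auto
  show ?thesis
  proof (rule bdd_aboveI)
    fix x assume "x \<in> (\<lambda>v. \<bar>LINT t|M. w t * v t\<bar>) ` dual_ball"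
    then show "x \<le> r" using pairing_le_amemiya[OF L_measurable[OF assms] _ _ k(1)] r
      by (auto simp: mo_class_def)
  qed
qed

lemma pairing_le_N: "w \<in> L \<Longrightarrow> v \<in> dual_ball \<Longrightarrow> \<bar>LINT t|M. w t * v t\<bar> \<le> N w"
  unfolding orlicz_norm_def by (rule cSUP_upper[OF _ bdd_pairing])

lemma N_nonneg: "w \<in> L \<Longrightarrow> 0 \<le> N w"
  using pairing_le_N[OF _ zero_in_dual_ball] by simp

lemma N_le_amemiya:
  assumes w: "w \<in> L" and k: "k > 0"
  shows "ennreal (N w) \<le> amemiya M \<Phi> w k"
proof (cases "amemiya M \<Phi> w k")
  case (real r)
  have "N w \<le> r" unfolding orlicz_norm_def
  proof (rule cSUP_least)
    fix v assume "v \<in> dual_ball"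
    then show "\<bar>LINT t|M. w t * v t\<bar> \<le> r"
      using pairing_le_amemiya[OF L_measurable[OF w] _ _ k] real by (auto simp: mo_class_def)
  qed (use zero_in_dual_ball in blast)
  then show ?thesis using real by (simp add: ennreal_leI)
qed simp

text \<open>Multiplying \<open>v\<close> by the sign of \<open>w\<close> does not leave the dual
  ball and turns the signed pairing into the pairing with the absolute value of
  \<open>w\<close>.\<close>

lemma nn_pairing_le_N:
  assumes w: "w \<in> L" and v: "v \<in> borel_measurable M" "\<And>t. 0 \<le> v t" "J v \<le> 1"
  shows "(\<integral>\<^sup>+ t. ennreal (v t) * ennreal \<bar>w t\<bar> \<partial>M) \<le> ennreal (N w)"
proof -
  note [measurable] = L_measurable[OF w] v(1)
  define v' where "v' t = sgn (w t) * v t" for t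
  have [measurable]: "v' \<in> borel_measurable M" unfolding v'_def by measurable
  have "J v' \<le> J v" unfolding modular_def
  proof (intro nn_integral_mono)
    fix t show "compl_fun \<Phi> t (ennreal \<bar>v' t\<bar>) \<le> compl_fun \<Phi> t (ennreal \<bar>v t\<bar>)"
      by (cases "w t = 0") (auto simp: v'_def abs_mult abs_sgn_eq)
  qed
  also note v(3)
  finally have v': "v' \<in> dual_ball" by (auto simp: mo_class_def intro: le_less_trans)
  have *: "w t * v' t = v t * \<bar>w t\<bar>" for t by (simp add: v'_def abs_sgn mult_ac)
  have "(\<integral>\<^sup>+ t. ennreal (v t) * ennreal \<bar>w t\<bar> \<partial>M) = (\<integral>\<^sup>+ t. ennreal (w t * v' t) \<partial>M)"
    using v(2) by (simp add: * flip: ennreal_mult)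
  also have "\<dots> = ennreal (LINT t|M. w t * v' t)"
    using v' v(2) by (intro nn_integral_eq_integral product_integrable w mo_class_subset) (auto simp: *)
  also have "\<dots> \<le> ennreal (N w)" using pairing_le_N[OF w v'] by (intro ennreal_leI) auto
  finally show ?thesis .
qed

lemma nn_pairing_add:
  assumes [measurable]: "w \<in> borel_measurable M" "v1 \<in> borel_measurable M" "v2 \<in> borel_measurable M"
    and "\<And>t. 0 \<le> v1 t" "\<And>t. 0 \<le> v2 t" "0 \<le> \<theta>" "\<theta> \<le> 1"
  shows "(\<integral>\<^sup>+ t. ennreal (\<theta> * v1 t + (1 - \<theta>) * v2 t) * ennreal \<bar>w t\<bar> \<partial>M)
    = ennreal \<theta> * (\<integral>\<^sup>+ t. ennreal (v1 t) * ennreal \<bar>w t\<bar> \<partial>M) + ennreal (1 - \<theta>) * (\<integral>\<^sup>+ t. ennreal (v2 t) * ennreal \<bar>w t\<bar> \<partial>M)"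
  using assms(4-) by (simp add: ennreal_plus ennreal_mult distrib_right nn_integral_add nn_integral_cmult mult.assoc)

lemma J_convex:
  assumes [measurable]: "v1 \<in> borel_measurable M" "v2 \<in> borel_measurable M"
    and nn: "\<And>t. 0 \<le> v1 t" "\<And>t. 0 \<le> v2 t" "0 \<le> \<theta>" "\<theta> \<le> 1"
  shows "J (\<lambda>t. \<theta> * v1 t + (1 - \<theta>) * v2 t) \<le> ennreal \<theta> * J v1 + ennreal (1 - \<theta>) * J v2"
proof -
  note [measurable] = measurable_compl[OF assms(1)] measurable_compl[OF assms(2)]
  have "J (\<lambda>t. \<theta> * v1 t + (1 - \<theta>) * v2 t) \<le> (\<integral>\<^sup>+ t. ennreal \<theta> * compl_fun \<Phi> t (ennreal \<bar>v1 t\<bar>) + ennreal (1 - \<theta>) * compl_fun \<Phi> t (ennreal \<bar>v2 t\<bar>) \<partial>M)"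
    unfolding modular_def
  proof (intro nn_integral_mono)
    fix t
    have eq: "\<bar>\<theta> * v1 t + (1 - \<theta>) * v2 t\<bar> = \<theta> * \<bar>v1 t\<bar> + (1 - \<theta>) * \<bar>v2 t\<bar>" using nn by simp
    show "compl_fun \<Phi> t (ennreal \<bar>\<theta> * v1 t + (1 - \<theta>) * v2 t\<bar>)
      \<le> ennreal \<theta> * compl_fun \<Phi> t (ennreal \<bar>v1 t\<bar>) + ennreal (1 - \<theta>) * compl_fun \<Phi> t (ennreal \<bar>v2 t\<bar>)"
      unfolding eq using nn(3,4) by (intro compl_convex) auto
  qed
  also have "\<dots> = ennreal \<theta> * J v1 + ennreal (1 - \<theta>) * J v2"
    by (simp add: modular_def nn_integral_add nn_integral_cmult)
  finally show ?thesis .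
qed

text \<open>Maximising the pairing under \<open>J v \<le> 1\<close> has value at most
  \<open>N w\<close>. A multiplier \<open>l\<close> bounds pairing minus \<open>l * J v\<close> by
  \<open>N w - l\<close> without constraint. Dividing by \<open>l\<close> and conjugating gives
  \<open>I (w / l) \<le> (N w - l) / l\<close>, so the Amemiya value at \<open>1 / l\<close> is at
  most \<open>N w\<close>.\<close>

lemma amemiya_le_N:
  assumes w: "w \<in> L"
  shows "(INF k\<in>{0<..}. amemiya M \<Phi> w k) \<le> ennreal (N w)"
proof -
  note wm [measurable] = L_measurable[OF w]
  define pair where "pair v = (\<integral>\<^sup>+ t. ennreal (v t) * ennreal \<bar>w t\<bar> \<partial>M)" for v
  define V where "V = {v \<in> borel_measurable M. (\<forall>t. 0 \<le> v t) \<and> J v < top}"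
  have pair_fin: "pair v < top" if "v \<in> V" for v
  proof -
    have "v \<in> mo_space M (compl_fun \<Phi>)" using that by (intro mo_class_subset) (auto simp: mo_class_def V_def)
    then show ?thesis using product_finite[OF w, of v] that
      by (simp add: pair_def V_def abs_mult ennreal_mult' mult.commute)
  qed
  define P where "P = (\<lambda>v. (enn2real (pair v), enn2real (J v))) ` V"
  have "(\<lambda>t. 0) \<in> V" by (simp add: V_def modular_def)
  then have zero: "(0, 0) \<in> P" unfolding P_def by (rule rev_image_eqI) (simp add: modular_def pair_def)
  have mix: "\<theta> * a1 + (1 - \<theta>) * a2 \<le> N w"
    if P: "(a1, b1) \<in> P" "(a2, b2) \<in> P" and \<theta>: "0 \<le> \<theta>" "\<theta> \<le> 1" and le: "\<theta> * b1 + (1 - \<theta>) * b2 \<le> 1"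
    for a1 b1 a2 b2 \<theta> :: real
  proof -
    from P obtain v1 v2 where v: "v1 \<in> V" "v2 \<in> V" "a1 = enn2real (pair v1)" "b1 = enn2real (J v1)"
      "a2 = enn2real (pair v2)" "b2 = enn2real (J v2)" by (auto simp: P_def)
    have e: "pair v1 = ennreal a1" "pair v2 = ennreal a2" "J v1 = ennreal b1" "J v2 = ennreal b2"
      using v pair_fin by (auto simp: V_def)
    have nn: "0 \<le> a1" "0 \<le> a2" "0 \<le> b1" "0 \<le> b2" using v by auto
    define v' where "v' t = \<theta> * v1 t + (1 - \<theta>) * v2 t" for t
    have m [measurable]: "v1 \<in> borel_measurable M" "v2 \<in> borel_measurable M" using v by (auto simp: V_def)
    have pos: "\<And>t. 0 \<le> v1 t" "\<And>t. 0 \<le> v2 t" using v by (auto simp: V_def)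
    have "J v' \<le> ennreal \<theta> * ennreal b1 + ennreal (1 - \<theta>) * ennreal b2"
      unfolding v'_def e[symmetric] using m pos \<theta> by (rule J_convex)
    also have "\<dots> = ennreal (\<theta> * b1 + (1 - \<theta>) * b2)" using nn \<theta> by (simp add: ennreal_mult)
    also have "\<dots> \<le> 1" using le by (simp add: ennreal_le_1 del: ennreal_plus)
    finally have J1: "J v' \<le> 1" .
    have "pair v' \<le> ennreal (N w)" unfolding pair_def
    proof (rule nn_pairing_le_N[OF w])
      show "v' \<in> borel_measurable M" unfolding v'_def by measurable
      show "0 \<le> v' t" for t using pos \<theta> by (simp add: v'_def)
    qed (rule J1)
    also have "pair v' = ennreal \<theta> * ennreal a1 + ennreal (1 - \<theta>) * ennreal a2"
      unfolding pair_def v'_def e[symmetric] using wm m pos \<theta> by (rule nn_pairing_add)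
    also have "\<dots> = ennreal (\<theta> * a1 + (1 - \<theta>) * a2)" using nn \<theta> by (simp add: ennreal_mult)
    finally show "\<theta> * a1 + (1 - \<theta>) * a2 \<le> N w"
      using N_nonneg[OF w] by (simp add: ennreal_le_iff del: ennreal_plus)
  qed
  have "\<exists>l\<ge>0. \<forall>a b. (a, b) \<in> P \<longrightarrow> a \<le> N w + l * (b - 1)"
    by (rule lagrange_multiplier) (fact mix zero)+
  then obtain l where l: "0 \<le> l" "\<And>a b. (a, b) \<in> P \<Longrightarrow> a \<le> N w + l * (b - 1)" by blast
  \<comment> \<open>Keeps \<open>(N w - l) / m\<close> nonnegative, so that its embedding in the
    extended half-line is faithful.\<close>
  have l': "l \<le> N w" using l(2)[OF zero] by simp
  have "(INF k\<in>{0<..}. amemiya M \<Phi> w k) \<le> ennreal (N w + \<epsilon>)" if "0 < \<epsilon>" for \<epsilon>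
  proof -
    \<comment> \<open>The multiplier may be 0, so it is enlarged before division. The Amemiya value
      at \<open>1 / m\<close> then exceeds \<open>N w\<close> by at most \<epsilon>.\<close>
    define m where "m = l + \<epsilon>"
    have m: "0 < m" "l \<le> m" using l that by (auto simp: m_def)
    have wm': "(\<lambda>t. (1 / m) * w t) \<in> borel_measurable M" by measurable
    have "I (\<lambda>t. (1 / m) * w t) \<le> ennreal ((N w - l) / m)"
    proof (rule ccontr)
      assume "\<not> ?thesis"
      then have "ennreal ((N w - l) / m) < I (\<lambda>t. (1 / m) * w t)" by simp
      then obtain v where v: "v \<in> borel_measurable M" "\<And>t. 0 \<le> v t" "J v < top"
        "ennreal ((N w - l) / m) + J v < (\<integral>\<^sup>+ t. ennreal (v t) * ennreal \<bar>(1 / m) * w t\<bar> \<partial>M)"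
        using modular_dual_approx[OF wm'] by blast
      note [measurable] = v(1)
      have V: "v \<in> V" using v by (simp add: V_def)
      obtain a b where ab: "pair v = ennreal a" "J v = ennreal b" "0 \<le> a" "0 \<le> b"
        using pair_fin[OF V] v(3) by (cases "pair v"; cases "J v") auto
      have "(a, b) \<in> P" using V ab by (auto simp: P_def intro!: rev_image_eqI[of v])
      then have "a \<le> N w + l * (b - 1)" by (rule l)
      also have "\<dots> \<le> N w - l + m * b" using mult_right_mono[OF m(2) ab(4)] by (simp add: algebra_simps)
      finally have "a / m \<le> (N w - l) / m + b" using m by (simp add: field_simps)
      moreover have "(\<integral>\<^sup>+ t. ennreal (v t) * ennreal \<bar>(1 / m) * w t\<bar> \<partial>M) = ennreal (1 / m) * pair v"
        using m unfolding pair_def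
        by (subst nn_integral_cmult[symmetric]) (auto simp: abs_mult mult_ac simp flip: ennreal_mult)
      then have "(\<integral>\<^sup>+ t. ennreal (v t) * ennreal \<bar>(1 / m) * w t\<bar> \<partial>M) = ennreal (a / m)"
        using m ab by (simp flip: ennreal_mult)
      with v(4) have "ennreal ((N w - l) / m + b) < ennreal (a / m)" using ab l' m by simp
      then have "(N w - l) / m + b < a / m" using ab l' m by (simp add: ennreal_less_iff del: ennreal_plus)
      ultimately show False by simp
    qed
    then have "amemiya M \<Phi> w (1 / m) \<le> (1 + ennreal ((N w - l) / m)) / ennreal (1 / m)"
      unfolding amemiya_def by (intro divide_right_mono_ennreal add_left_mono)
    also have "\<dots> = ennreal (1 + (N w - l) / m) / ennreal (1 / m)"
      using l' m by simp
    also have "\<dots> = ennreal ((1 + (N w - l) / m) / (1 / m))"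
      using l' m by (intro divide_ennreal) auto
    also have "(1 + (N w - l) / m) / (1 / m) = N w + \<epsilon>" using m by (simp add: field_simps m_def)
    finally show ?thesis using m by (intro INF_lower2[of "1 / m"]) auto
  qed
  then have "(INF k\<in>{0<..}. amemiya M \<Phi> w k) \<le> ennreal (N w) + ennreal \<epsilon>" if "0 < \<epsilon>" for \<epsilon>
    using that N_nonneg[OF w] by simp
  then show ?thesis by (rule ennreal_le_epsilon)
qed

lemma N_eq_amemiya: "w \<in> L \<Longrightarrow> ennreal (N w) = (INF k\<in>{0<..}. amemiya M \<Phi> w k)"
  by (intro antisym amemiya_le_N INF_greatest N_le_amemiya) auto

end

subsection \<open>Functionals\<close>

context mo_setting
begin

abbreviation "D \<equiv> mo_dual M \<Phi>"

lemma L_zero: "(\<lambda>t. 0) \<in> L" by (intro L_I) auto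

lemma dual_add: "f \<in> D \<Longrightarrow> w \<in> L \<Longrightarrow> z \<in> L \<Longrightarrow> f (\<lambda>t. w t + z t) = f w + f z"
  by (simp add: mo_dual_def)

lemma dual_scale: "f \<in> D \<Longrightarrow> w \<in> L \<Longrightarrow> f (\<lambda>t. c * w t) = c * f w"
  by (simp add: mo_dual_def)

lemma dual_diff: "f \<in> D \<Longrightarrow> w \<in> L \<Longrightarrow> z \<in> L \<Longrightarrow> f (\<lambda>t. w t - z t) = f w - f z"
  using dual_add[OF _ _ L_scale, of f w z "-1"] dual_scale[of f z "-1"] by simp

lemma dual_zero: "f \<in> D \<Longrightarrow> f (\<lambda>t. 0) = 0"
  using dual_scale[OF _ L_zero, of f 0] by simp

lemma dual_uminus: "f \<in> D \<Longrightarrow> (\<lambda>z. - f z) \<in> D"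
  by (auto simp: mo_dual_def)

lemma dual_bound: assumes "f \<in> D" obtains C where "0 \<le> C" "\<And>w. w \<in> L \<Longrightarrow> \<bar>f w\<bar> \<le> C * N w"
proof -
  from assms have "\<exists>C. \<forall>w\<in>L. \<bar>f w\<bar> \<le> C * N w" by (simp add: mo_dual_def)
  then obtain C where C: "\<And>w. w \<in> L \<Longrightarrow> \<bar>f w\<bar> \<le> C * N w" by blast
  show thesis
  proof (rule that[of "max C 0"])
    fix w assume w: "w \<in> L"
    have "C * N w \<le> max C 0 * N w" using N_nonneg[OF w] by (intro mult_right_mono) auto
    with C[OF w] show "\<bar>f w\<bar> \<le> max C 0 * N w" by simp
  qed simp
qed

lemma N_AE_zero: assumes "AE t in M. w t = 0" shows "N w = 0"
proof -
  have "(LINT t|M. w t * v t) = 0" for v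
    by (rule integral_eq_zero_AE) (use assms in \<open>auto elim: eventually_mono\<close>)
  moreover have "dual_ball \<noteq> {}" using zero_in_dual_ball by blast
  ultimately show ?thesis unfolding orlicz_norm_def by simp
qed

lemma dual_AE_zero: assumes "f \<in> D" "w \<in> L" "AE t in M. w t = 0" shows "f w = 0"
proof -
  obtain C where "\<bar>f w\<bar> \<le> C * N w" using dual_bound[OF assms(1)] assms(2) by metis
  then show ?thesis using N_AE_zero[OF assms(3)] by simp
qed

lemma dual_AE_cong: assumes "f \<in> D" "w \<in> L" "z \<in> L" "AE t in M. w t = z t" shows "f w = f z"
  using dual_AE_zero[OF assms(1) L_diff[OF assms(2,3)]] dual_diff[OF assms(1-3)] assms(4) by simp

lemma bdd_dual_quotient:
  assumes "f \<in> D" shows "bdd_above ((\<lambda>w. \<bar>f w\<bar> / N w) ` {w \<in> L. \<not> (AE t in M. w t = 0)})"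
proof -
  obtain C where C: "0 \<le> C" "\<And>w. w \<in> L \<Longrightarrow> \<bar>f w\<bar> \<le> C * N w" using dual_bound[OF assms] by blast
  have "\<bar>f w\<bar> / N w \<le> C" if "w \<in> L" for w
    using C(2)[OF that] N_nonneg[OF that] C(1) by (cases "N w = 0") (auto simp: pos_divide_le_eq)
  then show ?thesis by (auto intro!: bdd_aboveI)
qed

lemma abs_le_dual_norm:
  assumes f: "f \<in> D" and w: "w \<in> L" shows "\<bar>f w\<bar> \<le> dual_norm M \<Phi> f * N w"
\<comment> \<open>Here the quotient in \<open>dual_norm\<close> is absent or a division by 0, but
  boundedness alone forces \<open>f w = 0\<close>.\<close>
proof (cases "(AE t in M. w t = 0) \<or> N w = 0")
  case True
  obtain C where "\<bar>f w\<bar> \<le> C * N w" using dual_bound[OF f] w by metis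
  then show ?thesis using True N_AE_zero[of w] by auto
next
  case False
  then have "\<bar>f w\<bar> / N w \<le> dual_norm M \<Phi> f"
    unfolding dual_norm_def using w by (intro cSUP_upper bdd_dual_quotient f) auto
  then show ?thesis using False N_nonneg[OF w] by (simp add: pos_divide_le_eq)
qed

text \<open>The nonzero \<open>u\<close> witnesses that the supremum ranges over a nonempty
  set.\<close>

lemma dual_norm_le:
  assumes u: "u \<in> L" "\<not> (AE t in M. u t = 0)" and "0 \<le> c" and le: "\<And>w. w \<in> L \<Longrightarrow> \<bar>f w\<bar> \<le> c * N w"
  shows "dual_norm M \<Phi> f \<le> c"
  unfolding dual_norm_def
proof (rule cSUP_least)
  fix w assume "w \<in> {w \<in> L. \<not> (AE t in M. w t = 0)}"
  then have w: "w \<in> L" by simp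
  show "\<bar>f w\<bar> / N w \<le> c"
    using le[OF w] N_nonneg[OF w] \<open>0 \<le> c\<close> by (cases "N w = 0") (auto simp: pos_divide_le_eq)
qed (use u in blast)

lemma dual_norm_nonneg:
  assumes u: "u \<in> L" "\<not> (AE t in M. u t = 0)" and f: "f \<in> D"
  shows "0 \<le> dual_norm M \<Phi> f"
proof -
  have "0 \<le> \<bar>f u\<bar> / N u" using N_nonneg[OF u(1)] by simp
  also have "\<dots> \<le> dual_norm M \<Phi> f"
    unfolding dual_norm_def using u by (intro cSUP_upper bdd_dual_quotient f) auto
  finally show ?thesis .
qed

text \<open>Infinite modulars are sent to 0, so \<open>R w\<close> is informative only next to
  \<open>I w < top\<close>.\<close>

abbreviation "R w \<equiv> enn2real (I w)"

lemma amemiya_real: "k > 0 \<Longrightarrow> I (\<lambda>t. k * w t) < top \<Longrightarrow>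
    amemiya M \<Phi> w k = ennreal ((1 + R (\<lambda>t. k * w t)) / k)"
  by (cases "I (\<lambda>t. k * w t)") (auto simp: amemiya_def divide_ennreal simp flip: ennreal_1 ennreal_plus)

lemma N_le:
  assumes "w \<in> L" "k > 0" "I (\<lambda>t. k * w t) < top" shows "N w \<le> (1 + R (\<lambda>t. k * w t)) / k"
proof -
  have "ennreal (N w) \<le> ennreal ((1 + R (\<lambda>t. k * w t)) / k)"
    using N_le_amemiya[OF assms(1,2)] by (simp add: amemiya_real[OF assms(2,3)])
  then show ?thesis using assms(2) by (subst (asm) ennreal_le_iff) auto
qed

lemma amemiya_top: "k > 0 \<Longrightarrow> I (\<lambda>t. k * w t) = top \<Longrightarrow> amemiya M \<Phi> w k = top"
  by (simp add: amemiya_def ennreal_top_divide)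

lemma N_approx:
  assumes w: "w \<in> L" and "0 < e"
  obtains k where "k > 0" "I (\<lambda>t. k * w t) < top" "(1 + R (\<lambda>t. k * w t)) / k < N w + e"
proof -
  have "(INF k\<in>{0<..}. amemiya M \<Phi> w k) < ennreal (N w + e)"
    using N_nonneg[OF w] \<open>0 < e\<close> unfolding N_eq_amemiya[OF w, symmetric] by (simp add: ennreal_less_iff del: ennreal_plus)
  then obtain k where k: "k > 0" "amemiya M \<Phi> w k < ennreal (N w + e)" by (auto simp: INF_less_iff)
  then have fin: "I (\<lambda>t. k * w t) < top" using amemiya_top[of k w] by (cases "I (\<lambda>t. k * w t)") auto
  from k(2) have "(1 + R (\<lambda>t. k * w t)) / k < N w + e"
    unfolding amemiya_real[OF k(1) fin] using k(1) by (subst (asm) ennreal_less_iff) auto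
  with k fin that show thesis by blast
qed

text \<open>Turns a one-sided modular bound into a norm bound: apply it to \<open>k * w\<close> and
  \<open>- k * w\<close>, divide by \<open>k\<close>, and let \<open>k\<close> approach the Amemiya
  infimum.\<close>

lemma abs_le_N_if_le_modular:
  assumes f: "f \<in> D" and "0 \<le> c" and le: "\<And>w. w \<in> L \<Longrightarrow> I w < top \<Longrightarrow> f w \<le> c * (1 + R w)" and w: "w \<in> L"
  shows "\<bar>f w\<bar> \<le> c * N w"
proof -
  have *: "\<bar>f w\<bar> \<le> c * (N w + e)" if "0 < e" for e
  proof -
    obtain k where k: "k > 0" "I (\<lambda>t. k * w t) < top" "(1 + R (\<lambda>t. k * w t)) / k < N w + e"
      using N_approx[OF w \<open>0 < e\<close>] by blast
    have m: "I (\<lambda>t. (- k) * w t) = I (\<lambda>t. k * w t)" by (simp add: modular_def)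
    have "k * f w \<le> c * (1 + R (\<lambda>t. k * w t))"
      using le[OF L_scale[OF w], of k] k(2) by (simp add: dual_scale[OF f w])
    moreover have "- k * f w \<le> c * (1 + R (\<lambda>t. k * w t))"
      using le[OF L_scale[OF w], of "- k"] k(2) m by (simp add: dual_scale[OF f w, of "- k", simplified])
    ultimately have "k * \<bar>f w\<bar> \<le> c * (1 + R (\<lambda>t. k * w t))" by (simp add: abs_if)
    then have "\<bar>f w\<bar> \<le> c * ((1 + R (\<lambda>t. k * w t)) / k)" using k(1) by (simp add: field_simps)
    also have "\<dots> \<le> c * (N w + e)" using k(3) \<open>0 \<le> c\<close> by (intro mult_left_mono) auto
    finally show ?thesis .
  qed
  have "\<bar>f w\<bar> \<le> c * N w + e" if "0 < e" for e
  proof -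
    \<comment> \<open>The denominator \<open>c + 1\<close> also covers \<open>c = 0\<close>.\<close>
    have "\<bar>f w\<bar> \<le> c * (N w + e / (c + 1))" using that \<open>0 \<le> c\<close> by (intro *) simp
    also have "\<dots> \<le> c * N w + e" using that \<open>0 \<le> c\<close> by (simp add: field_simps)
    finally show ?thesis .
  qed
  then show ?thesis by (rule field_le_epsilon)
qed

subsection \<open>Purely singular functionals\<close>

abbreviation "pos f \<equiv> pos_part_fun M \<Phi> f"
abbreviation "oc g \<equiv> oc_part_pos M \<Phi> g"

text \<open>Order intervals are norm bounded: one scaling constant for \<open>u\<close> serves
  everything below \<open>u\<close>. This makes the supremum in \<open>pos_part_fun\<close>
  meaningful.\<close>

lemma bdd_pos:
  assumes f: "f \<in> D" and u: "u \<in> L"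
  shows "bdd_above (f ` {w \<in> L. AE t in M. 0 \<le> w t \<and> w t \<le> u t})"
proof -
  obtain C where C: "0 \<le> C" "\<And>w. w \<in> L \<Longrightarrow> \<bar>f w\<bar> \<le> C * N w" using dual_bound[OF f] by blast
  obtain c where c: "c > 0" "I (\<lambda>t. c * u t) < top" using u by (auto simp: mo_space_def)
  have "f w \<le> C * ((1 + R (\<lambda>t. c * u t)) / c)" if w: "w \<in> L" "AE t in M. 0 \<le> w t \<and> w t \<le> u t" for w
  proof -
    have le: "I (\<lambda>t. c * w t) \<le> I (\<lambda>t. c * u t)"
    proof (rule I_mono)
      show "AE t in M. \<bar>c * w t\<bar> \<le> \<bar>c * u t\<bar>" using w(2)
        by eventually_elim (use c(1) in \<open>auto simp: abs_mult\<close>)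
    qed
    then have fin: "I (\<lambda>t. c * w t) < top" using c(2) by (rule le_less_trans)
    have "f w \<le> C * N w" using C(2)[OF w(1)] by simp
    also have "\<dots> \<le> C * ((1 + R (\<lambda>t. c * w t)) / c)" using C(1) by (intro mult_left_mono N_le w c fin)
    also have "\<dots> \<le> C * ((1 + R (\<lambda>t. c * u t)) / c)"
      using C(1) c le by (intro mult_left_mono divide_right_mono add_left_mono enn2real_mono) auto
    finally show ?thesis .
  qed
  then show ?thesis by (auto intro!: bdd_aboveI)
qed

lemma le_pos: "f \<in> D \<Longrightarrow> u \<in> L \<Longrightarrow> w \<in> L \<Longrightarrow> AE t in M. 0 \<le> w t \<and> w t \<le> u t \<Longrightarrow> f w \<le> pos f u"
  unfolding pos_part_fun_def by (intro cSUP_upper bdd_pos) auto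

lemma pos_least:
  assumes "AE t in M. 0 \<le> u t" "\<And>w. w \<in> L \<Longrightarrow> AE t in M. 0 \<le> w t \<and> w t \<le> u t \<Longrightarrow> f w \<le> c"
  shows "pos f u \<le> c"
  unfolding pos_part_fun_def
proof (rule cSUP_least)
  have "(\<lambda>t. 0) \<in> {w \<in> L. AE t in M. 0 \<le> w t \<and> w t \<le> u t}" using assms(1) L_zero by auto
  then show "{w \<in> L. AE t in M. 0 \<le> w t \<and> w t \<le> u t} \<noteq> {}" by blast
qed (use assms(2) in auto)

lemma pos_nonneg: "f \<in> D \<Longrightarrow> u \<in> L \<Longrightarrow> AE t in M. 0 \<le> u t \<Longrightarrow> 0 \<le> pos f u"
  using le_pos[of f u "\<lambda>t. 0"] by (simp add: L_zero dual_zero)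

lemma pos_mono:
  assumes "f \<in> D" "u \<in> L" "z \<in> L" "AE t in M. 0 \<le> u t" "AE t in M. u t \<le> z t"
  shows "pos f u \<le> pos f z"
proof (rule pos_least[OF assms(4)])
  fix w assume w: "w \<in> L" "AE t in M. 0 \<le> w t \<and> w t \<le> u t"
  have "AE t in M. 0 \<le> w t \<and> w t \<le> z t" using w(2) assms(5) by eventually_elim auto
  then show "f w \<le> pos f z" by (intro le_pos assms w)
qed

text \<open>Riesz decomposition: anything between 0 and \<open>u + z\<close> splits into its minimum
  with \<open>u\<close> and a remainder below \<open>z\<close>.\<close>

lemma pos_add:
  assumes f: "f \<in> D" and uz: "u \<in> L" "z \<in> L" and nn: "AE t in M. 0 \<le> u t" "AE t in M. 0 \<le> z t"
  shows "pos f (\<lambda>t. u t + z t) \<le> pos f u + pos f z"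
proof (rule pos_least)
  show "AE t in M. 0 \<le> u t + z t" using nn by eventually_elim auto
  fix w assume w: "w \<in> L" "AE t in M. 0 \<le> w t \<and> w t \<le> u t + z t"
  note [measurable] = L_measurable[OF w(1)] L_measurable[OF uz(1)]
  have a: "(\<lambda>t. min (w t) (u t)) \<in> L"
    by (rule L_solid[OF L_add[OF L_abs L_abs], OF w(1) uz(1)]) auto
  have "f w = f (\<lambda>t. min (w t) (u t)) + f (\<lambda>t. w t - min (w t) (u t))"
    using dual_diff[OF f w(1) a] by simp
  also have "\<dots> \<le> pos f u + pos f z"
  proof (intro add_mono le_pos f uz a L_diff[OF w(1) a])
    show "AE t in M. 0 \<le> min (w t) (u t) \<and> min (w t) (u t) \<le> u t"
      using w(2) nn by eventually_elim auto
    show "AE t in M. 0 \<le> w t - min (w t) (u t) \<and> w t - min (w t) (u t) \<le> z t"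
      using w(2) nn by eventually_elim auto
  qed
  finally show "f w \<le> pos f u + pos f z" .
qed

text \<open>The index set of the infimum in \<open>oc_part_pos\<close>.\<close>

definition inc_to :: "('a \<Rightarrow> real) \<Rightarrow> (nat \<Rightarrow> 'a \<Rightarrow> real) set" where
  "inc_to u = {U. (\<forall>n. U n \<in> L) \<and>
     (AE t in M. 0 \<le> U 0 t \<and> incseq (\<lambda>n. U n t) \<and> (\<lambda>n. U n t) \<longlonglongrightarrow> u t)}"

lemma inc_toD:
  assumes "U \<in> inc_to u"
  shows "U n \<in> L" "AE t in M. 0 \<le> U n t" "AE t in M. U n t \<le> u t"
proof -
  show "U n \<in> L" using assms by (simp add: inc_to_def)
  have ae: "AE t in M. 0 \<le> U 0 t \<and> incseq (\<lambda>n. U n t) \<and> (\<lambda>n. U n t) \<longlonglongrightarrow> u t"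
    using assms by (simp add: inc_to_def)
  from ae show "AE t in M. 0 \<le> U n t"
    by eventually_elim (metis incseqD le0 order.trans)
  from ae show "AE t in M. U n t \<le> u t"
    by eventually_elim (auto intro: incseq_le)
qed

lemma bdd_pos_seq: "f \<in> D \<Longrightarrow> u \<in> L \<Longrightarrow> U \<in> inc_to u \<Longrightarrow> bdd_above (range (\<lambda>n. pos f (U n)))"
  by (rule bdd_aboveI[of _ "pos f u"]) (auto intro!: pos_mono dest: inc_toD)

lemma SUP_pos_nonneg:
  assumes "f \<in> D" "u \<in> L" "U \<in> inc_to u" shows "0 \<le> (SUP n. pos f (U n))"
proof -
  have "0 \<le> pos f (U 0)" using assms inc_toD by (intro pos_nonneg) auto
  also have "\<dots> \<le> (SUP n. pos f (U n))" by (rule cSUP_upper[OF _ bdd_pos_seq[OF assms]]) simp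
  finally show ?thesis .
qed

lemma oc_eq: "oc g u = (INF U\<in>inc_to u. SUP n. g (U n))"
  by (simp add: oc_part_pos_def inc_to_def)

lemma bdd_oc: "f \<in> D \<Longrightarrow> u \<in> L \<Longrightarrow> bdd_below ((\<lambda>U. SUP n. pos f (U n)) ` inc_to u)"
  by (rule bdd_belowI[of _ 0]) (auto intro: SUP_pos_nonneg)

lemma const_inc_to: "u \<in> L \<Longrightarrow> AE t in M. 0 \<le> u t \<Longrightarrow> (\<lambda>n. u) \<in> inc_to u"
  by (simp add: inc_to_def)

lemma oc_nonneg: "f \<in> D \<Longrightarrow> u \<in> L \<Longrightarrow> AE t in M. 0 \<le> u t \<Longrightarrow> 0 \<le> oc (pos f) u"
  unfolding oc_eq using const_inc_to by (intro cINF_greatest SUP_pos_nonneg) auto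

lemma oc_le_SUP: "f \<in> D \<Longrightarrow> u \<in> L \<Longrightarrow> U \<in> inc_to u \<Longrightarrow> oc (pos f) u \<le> (SUP n. pos f (U n))"
  unfolding oc_eq by (intro cINF_lower bdd_oc) auto

lemma oc_le_pos: "f \<in> D \<Longrightarrow> u \<in> L \<Longrightarrow> AE t in M. 0 \<le> u t \<Longrightarrow> oc (pos f) u \<le> pos f u"
  using oc_le_SUP[OF _ _ const_inc_to, of f u] by simp

lemma oc_approx:
  assumes "f \<in> D" "u \<in> L" "AE t in M. 0 \<le> u t" "0 < e"
  obtains U where "U \<in> inc_to u" "\<And>n. pos f (U n) < oc (pos f) u + e"
proof -
  have "inc_to u \<noteq> {}" using const_inc_to[OF assms(2,3)] by blast
  moreover have "(INF U\<in>inc_to u. SUP n. pos f (U n)) < oc (pos f) u + e" using assms(4) by (simp add: oc_eq)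
  ultimately obtain U where U: "U \<in> inc_to u" "(SUP n. pos f (U n)) < oc (pos f) u + e"
    using bdd_oc[OF assms(1,2)] by (auto simp: cINF_less_iff)
  have "pos f (U n) \<le> (SUP n. pos f (U n))" for n
    by (rule cSUP_upper[OF _ bdd_pos_seq[OF assms(1,2) U(1)]]) simp
  with U that show thesis by (meson le_less_trans)
qed

text \<open>Near-optimal increasing sequences for \<open>u\<close> and for \<open>z\<close> add up
  to an admissible one for the sum.\<close>

lemma oc_add:
  assumes f: "f \<in> D" and uz: "u \<in> L" "z \<in> L" and nn: "AE t in M. 0 \<le> u t" "AE t in M. 0 \<le> z t"
  shows "oc (pos f) (\<lambda>t. u t + z t) \<le> oc (pos f) u + oc (pos f) z"
proof (rule field_le_epsilon)
  fix e :: real assume "0 < e"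
  then have e: "0 < e / 2" by simp
  obtain U where U: "U \<in> inc_to u" "\<And>n. pos f (U n) < oc (pos f) u + e / 2"
    using oc_approx[OF f uz(1) nn(1) e] by blast
  obtain Z where Z: "Z \<in> inc_to z" "\<And>n. pos f (Z n) < oc (pos f) z + e / 2"
    using oc_approx[OF f uz(2) nn(2) e] by blast
  have UZ: "(\<lambda>n t. U n t + Z n t) \<in> inc_to (\<lambda>t. u t + z t)"
  proof -
    have "AE t in M. 0 \<le> U 0 t \<and> incseq (\<lambda>n. U n t) \<and> (\<lambda>n. U n t) \<longlonglongrightarrow> u t"
      "AE t in M. 0 \<le> Z 0 t \<and> incseq (\<lambda>n. Z n t) \<and> (\<lambda>n. Z n t) \<longlonglongrightarrow> z t"
      using U(1) Z(1) by (auto simp: inc_to_def)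
    then have "AE t in M. 0 \<le> U 0 t + Z 0 t \<and> incseq (\<lambda>n. U n t + Z n t) \<and> (\<lambda>n. U n t + Z n t) \<longlonglongrightarrow> u t + z t"
      by eventually_elim (auto intro!: tendsto_add simp: incseq_def add_mono)
    then show ?thesis using U(1) Z(1) by (auto simp: inc_to_def intro: L_add)
  qed
  have "oc (pos f) (\<lambda>t. u t + z t) \<le> (SUP n. pos f (\<lambda>t. U n t + Z n t))"
    by (rule oc_le_SUP[OF f L_add[OF uz] UZ])
  also have "\<dots> \<le> oc (pos f) u + oc (pos f) z + e"
  proof (rule cSUP_least)
    fix n
    have "pos f (\<lambda>t. U n t + Z n t) \<le> pos f (U n) + pos f (Z n)"
      by (intro pos_add f inc_toD[OF U(1)] inc_toD[OF Z(1)])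
    with U(2)[of n] Z(2)[of n] show "pos f (\<lambda>t. U n t + Z n t) \<le> oc (pos f) u + oc (pos f) z + e" by simp
  qed simp
  finally show "oc (pos f) (\<lambda>t. u t + z t) \<le> oc (pos f) u + oc (pos f) z + e" .
qed

lemma oc_zero: assumes f: "f \<in> D" shows "oc (pos f) (\<lambda>t. 0) = 0"
proof (rule antisym)
  have "oc (pos f) (\<lambda>t. 0) \<le> pos f (\<lambda>t. 0)" by (intro oc_le_pos f L_zero) simp
  also have "\<dots> \<le> 0"
  proof (rule pos_least)
    fix w assume w: "w \<in> L" "AE t in M. 0 \<le> w t \<and> w t \<le> (0::real)"
    have "AE t in M. w t = 0" using w(2) by eventually_elim simp
    then show "f w \<le> 0" using dual_AE_zero[OF f w(1)] by simp
  qed simp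
  finally show "oc (pos f) (\<lambda>t. 0) \<le> 0" .
qed (simp add: oc_nonneg f L_zero)

section \<open>Concentration of a purely singular functional\<close>

context
  fixes s :: "('a \<Rightarrow> real) \<Rightarrow> real"
  assumes singular: "purely_singular M \<Phi> s"
begin

lemma s_dual: "s \<in> D" using singular by (simp add: purely_singular_def)

text \<open>For nonnegative \<open>w\<close> the terms from its negative part vanish, so pure
  singularity reads as this equality and gives nothing stronger directly.\<close>

lemma oc_pos_eq_oc_neg:
  assumes "w \<in> L" "\<And>t. 0 \<le> w t"
  shows "oc (pos s) w = oc (pos (\<lambda>z. - s z)) w"
proof -
  have "(\<lambda>t. max (w t) 0) = w" "(\<lambda>t. max (- w t) 0) = (\<lambda>t. 0)" using assms(2) by (auto simp: max_absorb1 max_absorb2)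
  moreover have "oc_part M \<Phi> s w = 0" using singular assms(1) by (simp add: purely_singular_def)
  ultimately show ?thesis
    using oc_zero[OF s_dual] oc_zero[OF dual_uminus[OF s_dual]] by (simp add: oc_part_def Let_def)
qed

text \<open>The positive and negative parts of \<open>s\<close> are disjoint, hence so are their order continuous
  components; being equal, these vanish.\<close>

lemma oc_singular_zero:
  assumes w: "w \<in> L" "\<And>t. 0 \<le> w t"
  shows "oc (pos s) w = 0" "oc (pos (\<lambda>z. - s z)) w = 0"
proof -
  note ms = dual_uminus[OF s_dual]
  have "oc (pos s) w \<le> 0 + e" if "0 < e" for e
  proof -
    have "{z \<in> L. AE t in M. 0 \<le> z t \<and> z t \<le> w t} \<noteq> {}" using w by auto
    moreover have "pos s w - e / 2 < (SUP z\<in>{z \<in> L. AE t in M. 0 \<le> z t \<and> z t \<le> w t}. s z)"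
      using that by (simp add: pos_part_fun_def)
    ultimately obtain z where z: "z \<in> L" "AE t in M. 0 \<le> z t \<and> z t \<le> w t" "pos s w - e / 2 < s z"
      using bdd_pos[OF s_dual w(1)] by (auto simp: less_cSUP_iff)
    note [measurable] = L_measurable[OF z(1)] L_measurable[OF w(1)]
    \<comment> \<open>A version of \<open>z\<close> that satisfies the bounds at every point, as
      \<open>oc_pos_eq_oc_neg\<close> requires.\<close>
    define y where "y t = min (max (z t) 0) (w t)" for t
    have [measurable]: "y \<in> borel_measurable M" unfolding y_def by measurable
    have y: "y \<in> L" by (rule L_solid[OF w(1)]) (use w(2) in \<open>auto simp: y_def\<close>)
    have y0: "0 \<le> y t" "y t \<le> w t" for t using w(2) by (auto simp: y_def)
    have "s y = s z" by (rule dual_AE_cong[OF s_dual y z(1)]) (use z(2) in \<open>eventually_elim, auto simp: y_def\<close>)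
    with z have sy: "pos s w - e / 2 < s y" by simp
    have wy: "(\<lambda>t. w t - y t) \<in> L" by (intro L_diff w y)
    \<comment> \<open>At \<open>y\<close> the functional nearly attains \<open>pos s w\<close>.
      Removing a piece of \<open>y\<close> cannot gain more than the deficit, so \<open>- s\<close>
      is small below \<open>y\<close>; likewise adding a piece of \<open>w - y\<close> shows that
      \<open>s\<close> is small there.\<close>
    have "pos (\<lambda>z. - s z) y \<le> e / 2"
    proof (rule pos_least)
      fix x assume x: "x \<in> L" "AE t in M. 0 \<le> x t \<and> x t \<le> y t"
      have "AE t in M. 0 \<le> y t - x t \<and> y t - x t \<le> w t"
        using x(2)
      proof eventually_elim
        case (elim t) then show ?case using y0[of t] by linarith
      qed
      then have "s (\<lambda>t. y t - x t) \<le> pos s w" by (intro le_pos s_dual w L_diff y x)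
      then show "- s x \<le> e / 2" using sy dual_diff[OF s_dual y x(1)] by simp
    qed (use y0 in simp)
    moreover have "pos s (\<lambda>t. w t - y t) \<le> e / 2"
    proof (rule pos_least)
      fix x assume x: "x \<in> L" "AE t in M. 0 \<le> x t \<and> x t \<le> w t - y t"
      have "AE t in M. 0 \<le> y t + x t \<and> y t + x t \<le> w t"
        using x(2)
      proof eventually_elim
        case (elim t) then show ?case using y0[of t] by linarith
      qed
      then have "s (\<lambda>t. y t + x t) \<le> pos s w" by (intro le_pos s_dual w L_add y x)
      then show "s x \<le> e / 2" using sy dual_add[OF s_dual y x(1)] by simp
    qed (use y0 in simp)
    moreover have "oc (pos s) y = oc (pos (\<lambda>z. - s z)) y" using y y0(1) by (rule oc_pos_eq_oc_neg)
    moreover have "oc (pos (\<lambda>z. - s z)) y \<le> pos (\<lambda>z. - s z) y" using y y0 by (intro oc_le_pos ms) auto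
    moreover have "oc (pos s) (\<lambda>t. w t - y t) \<le> pos s (\<lambda>t. w t - y t)" using wy y0 by (intro oc_le_pos s_dual) auto
    moreover have "oc (pos s) (\<lambda>t. y t + (w t - y t)) \<le> oc (pos s) y + oc (pos s) (\<lambda>t. w t - y t)"
      using y wy y0 by (intro oc_add s_dual) auto
    ultimately show ?thesis by simp
  qed
  then have "oc (pos s) w \<le> 0" by (rule field_le_epsilon)
  moreover have "0 \<le> oc (pos s) w" using w by (intro oc_nonneg s_dual) auto
  ultimately show "oc (pos s) w = 0" by (rule antisym)
  then show "oc (pos (\<lambda>z. - s z)) w = 0" using oc_pos_eq_oc_neg[OF w] by simp
qed

text \<open>As both components vanish at \<open>w\<close>, there are functions increasing to
  \<open>w\<close> below which \<open>s\<close> is uniformly small. Away from the sets where they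
  are still under half of \<open>w\<close>, twice these functions dominate \<open>w\<close>, and so
  anything bounded by \<open>w\<close>.\<close>

lemma singular_support:
  assumes w: "w \<in> L" "\<And>t. 0 \<le> w t" and e: "0 < e"
  obtains E :: "nat \<Rightarrow> 'a set" where "\<And>n. E n \<in> sets M" "AE t in M. eventually (\<lambda>n. t \<notin> E n) sequentially"
    "\<And>n y. y \<in> L \<Longrightarrow> (\<And>t. \<bar>y t\<bar> \<le> w t) \<Longrightarrow> (\<And>t. t \<in> E n \<Longrightarrow> y t = 0) \<Longrightarrow> \<bar>s y\<bar> \<le> e"
proof -
  note ms = dual_uminus[OF s_dual]
  have e4: "0 < e / 4" using e by simp
  have w0: "AE t in M. 0 \<le> w t" using w by simp
  obtain U where U: "U \<in> inc_to w" "\<And>n. pos s (U n) < e / 4"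
    using oc_approx[OF s_dual w(1) w0 e4] oc_singular_zero[OF w] by auto
  obtain V where V: "V \<in> inc_to w" "\<And>n. pos (\<lambda>z. - s z) (V n) < e / 4"
    using oc_approx[OF ms w(1) w0 e4] oc_singular_zero[OF w] by auto
  define W where "W n t = min (U n t) (V n t)" for n t
  note [measurable] = L_measurable[OF inc_toD(1)[OF U(1)]] L_measurable[OF inc_toD(1)[OF V(1)]] L_measurable[OF w(1)]
  have [measurable]: "W n \<in> borel_measurable M" for n unfolding W_def by measurable
  \<comment> \<open>The factor 2 leaves room: the minimum tends to \<open>w\<close> and need not
    reach it. Where \<open>w\<close> vanishes the strict inequality is almost surely
    impossible.\<close>
  define E where "E n = {t \<in> space M. 2 * W n t < w t}" for n
  have small: "\<bar>s x\<bar> \<le> e / 4" if x: "x \<in> L" "AE t in M. 0 \<le> x t \<and> x t \<le> W n t" for n x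
  proof -
    have "s x \<le> pos s (U n)"
      using x by (intro le_pos s_dual inc_toD[OF U(1)]) (auto simp: W_def elim!: eventually_mono)
    moreover have "- s x \<le> pos (\<lambda>z. - s z) (V n)"
      using x by (intro le_pos ms inc_toD[OF V(1)]) (auto simp: W_def elim!: eventually_mono)
    ultimately show ?thesis using U(2)[of n] V(2)[of n] by (simp add: abs_le_iff)
  qed
  have Wnn: "AE t in M. 0 \<le> W n t" for n
    using inc_toD(2)[OF U(1), of n] inc_toD(2)[OF V(1), of n] by eventually_elim (simp add: W_def)
  show thesis
  proof (rule that[of E])
    show "E n \<in> sets M" for n unfolding E_def by measurable
    have "AE t in M. (\<lambda>n. U n t) \<longlonglongrightarrow> w t" "AE t in M. (\<lambda>n. V n t) \<longlonglongrightarrow> w t"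
      using U(1) V(1) by (auto simp: inc_to_def elim!: eventually_mono)
    moreover have "AE t in M. \<forall>n. 0 \<le> W n t" using Wnn by (simp add: AE_all_countable)
    ultimately show "AE t in M. eventually (\<lambda>n. t \<notin> E n) sequentially"
    proof eventually_elim
      case (elim t)
      show ?case
      proof (cases "w t = 0")
        case True
        then show ?thesis using elim(3) by (simp add: E_def not_less)
      next
        case False
        have "(\<lambda>n. W n t) \<longlonglongrightarrow> min (w t) (w t)" unfolding W_def using elim(1,2) by (rule tendsto_min)
        moreover have "w t / 2 < min (w t) (w t)" using w(2)[of t] False by simp
        ultimately have "eventually (\<lambda>n. w t / 2 < W n t) sequentially" by (rule order_tendstoD(1))
        then show ?thesis by eventually_elim (simp add: E_def)
      qed
    qed
    fix n y assume y: "y \<in> L" "\<And>t. \<bar>y t\<bar> \<le> w t" "\<And>t. t \<in> E n \<Longrightarrow> y t = 0"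
    note [measurable] = L_measurable[OF y(1)]
    have half: "\<bar>s (\<lambda>t. max (c * y t) 0 / 2)\<bar> \<le> e / 4" "(\<lambda>t. max (c * y t) 0 / 2) \<in> L" if c: "c = 1 \<or> c = - 1" for c
    proof -
      show L: "(\<lambda>t. max (c * y t) 0 / 2) \<in> L"
        by (rule L_solid[OF y(1)]) (use c in auto)
      have "AE t in M. t \<in> space M" by simp
      with Wnn[of n] have "AE t in M. 0 \<le> max (c * y t) 0 / 2 \<and> max (c * y t) 0 / 2 \<le> W n t"
      proof eventually_elim
        case (elim t)
        show ?case
        proof (cases "t \<in> E n")
          case True then show ?thesis using y(3) elim by simp
        next
          case False
          then have "w t \<le> 2 * W n t" using elim by (simp add: E_def)
          then show ?thesis using y(2)[of t] c elim by auto
        qed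
      qed
      then show "\<bar>s (\<lambda>t. max (c * y t) 0 / 2)\<bar> \<le> e / 4" by (rule small[OF L])
    qed
    \<comment> \<open>Half of the positive and half of the negative part lie below
      \<open>W n\<close> almost everywhere; each contributes at most \<open>e / 4\<close>, which
      doubling and subtraction turn into \<open>e\<close>.\<close>
    have "y = (\<lambda>t. 2 * (max (1 * y t) 0 / 2 - max (- 1 * y t) 0 / 2))" by (auto simp: max_def)
    then have sy: "s y = 2 * (s (\<lambda>t. max (1 * y t) 0 / 2) - s (\<lambda>t. max (- 1 * y t) 0 / 2))"
      using dual_scale[OF s_dual L_diff[OF half(2) half(2)], of 1 "- 1" 2]
        dual_diff[OF s_dual half(2) half(2), of 1 "- 1"] by simp
    have triangle: "\<bar>2 * (a - b)\<bar> \<le> e" if "\<bar>a\<bar> \<le> e / 4" "\<bar>b\<bar> \<le> e / 4" for a b :: real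
    proof -
      have "a \<le> e / 4" "- a \<le> e / 4" "b \<le> e / 4" "- b \<le> e / 4" using that by (simp_all only: abs_le_iff)
      then have "2 * (a - b) \<le> e" "- (2 * (a - b)) \<le> e" by (simp_all add: field_simps)
      then show ?thesis by (simp only: abs_le_iff)
    qed
    show "\<bar>s y\<bar> \<le> e" unfolding sy
      by (rule triangle[OF half(1)[OF disjI1[OF refl]] half(1)[OF disjI2[OF refl]]])
  qed
qed

text \<open>The glued function minus \<open>w2\<close> vanishes on \<open>E n\<close> and is
  dominated by the sum of the absolute values of \<open>w1\<close> and \<open>w2\<close>.\<close>

lemma singular_glue:
  assumes w: "w1 \<in> L" "w2 \<in> L" and e: "0 < e"
  obtains E :: "nat \<Rightarrow> 'a set" where "\<And>n. E n \<in> sets M" "AE t in M. eventually (\<lambda>n. t \<notin> E n) sequentially"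
    "\<And>n. \<bar>s (\<lambda>t. if t \<in> E n then w2 t else w1 t) - s w2\<bar> \<le> e"
    "\<And>n. (\<lambda>t. if t \<in> E n then w2 t else w1 t) \<in> L"
proof -
  have wL: "(\<lambda>t. \<bar>w1 t\<bar> + \<bar>w2 t\<bar>) \<in> L" by (intro L_add L_abs w)
  note [measurable] = L_measurable[OF w(1)] L_measurable[OF w(2)]
  obtain E :: "nat \<Rightarrow> 'a set" where E: "\<And>n. E n \<in> sets M" "AE t in M. eventually (\<lambda>n. t \<notin> E n) sequentially"
    and small: "\<And>n y. y \<in> L \<Longrightarrow> (\<And>t. \<bar>y t\<bar> \<le> \<bar>w1 t\<bar> + \<bar>w2 t\<bar>) \<Longrightarrow> (\<And>t. t \<in> E n \<Longrightarrow> y t = 0) \<Longrightarrow> \<bar>s y\<bar> \<le> e"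
    using singular_support[OF wL _ e] by auto
  note [measurable] = E(1)
  have yL: "(\<lambda>t. if t \<in> E n then w2 t else w1 t) \<in> L" for n
    by (rule L_solid[OF wL]) auto
  have "\<bar>s (\<lambda>t. if t \<in> E n then w2 t else w1 t) - s w2\<bar> \<le> e" for n
    unfolding dual_diff[OF s_dual yL w(2), symmetric] by (rule small[OF L_diff[OF yL w(2)], of n n]) auto
  with E yL that show thesis by blast
qed

end

end

subsection \<open>Support functionals\<close>

lemma finite_nn_integral_enn2real:
  assumes g [measurable]: "g \<in> borel_measurable M" and fin: "(\<integral>\<^sup>+ t. g t \<partial>M) < top"
  shows "AE t in M. g t < top" "integrable M (\<lambda>t. enn2real (g t))"
    "enn2real (\<integral>\<^sup>+ t. g t \<partial>M) = (LINT t|M. enn2real (g t))"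
proof -
  show ae: "AE t in M. g t < top"
    using nn_integral_PInf_AE[OF g] fin by (auto simp: less_top)
  then have eq: "(\<integral>\<^sup>+ t. ennreal (enn2real (g t)) \<partial>M) = (\<integral>\<^sup>+ t. g t \<partial>M)"
    by (intro nn_integral_cong_AE) (auto elim!: eventually_mono)
  then show "integrable M (\<lambda>t. enn2real (g t))"
    using fin by (intro integrableI_nonneg) auto
  show "enn2real (\<integral>\<^sup>+ t. g t \<partial>M) = (LINT t|M. enn2real (g t))"
    by (subst integral_eq_nn_integral) (auto simp: eq)
qed

lemma integral_glue_tendsto:
  fixes h1 h2 :: "'a \<Rightarrow> real"
  assumes h [measurable]: "integrable M h1" "integrable M h2"
    and E [measurable]: "\<And>n. E n \<in> sets M" and ev: "AE t in M. eventually (\<lambda>n. t \<notin> E n) sequentially"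
  shows "(\<lambda>n. LINT t|M. (if t \<in> E n then h2 t else h1 t)) \<longlonglongrightarrow> (LINT t|M. h1 t)"
proof (rule integral_dominated_convergence)
  show "integrable M (\<lambda>t. \<bar>h1 t\<bar> + \<bar>h2 t\<bar>)" using h by simp
  show "AE t in M. (\<lambda>n. if t \<in> E n then h2 t else h1 t) \<longlonglongrightarrow> h1 t"
    using ev by eventually_elim (auto intro: tendsto_eventually elim!: eventually_mono)
qed auto

context mo_setting
begin

abbreviation "F w t \<equiv> enn2real (\<Phi> t (ennreal \<bar>w t\<bar>))"
abbreviation "G v t \<equiv> enn2real (compl_fun \<Phi> t (ennreal \<bar>v t\<bar>))"

lemma I_finite:
  assumes "w \<in> borel_measurable M" "I w < top"
  shows "AE t in M. \<Phi> t (ennreal \<bar>w t\<bar>) < top" "integrable M (F w)" "R w = (LINT t|M. F w t)"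
  using finite_nn_integral_enn2real[OF measurable_Phi[OF assms(1)]] assms(2) by (auto simp: modular_def)

lemma J_finite:
  assumes "v \<in> borel_measurable M" "J v < top"
  shows "AE t in M. compl_fun \<Phi> t (ennreal \<bar>v t\<bar>) < top" "integrable M (G v)" "enn2real (J v) = (LINT t|M. G v t)"
  using finite_nn_integral_enn2real[OF measurable_compl[OF assms(1)]] assms(2) by (auto simp: modular_def)

lemma I_glue_finite:
  assumes [measurable]: "w1 \<in> borel_measurable M" "w2 \<in> borel_measurable M" "A \<in> sets M"
    and "I w1 < top" "I w2 < top"
  shows "I (\<lambda>t. if t \<in> A then w2 t else w1 t) < top"
proof -
  note [measurable] = measurable_Phi[OF assms(1)] measurable_Phi[OF assms(2)]
  have "I (\<lambda>t. if t \<in> A then w2 t else w1 t) \<le> (\<integral>\<^sup>+ t. \<Phi> t (ennreal \<bar>w1 t\<bar>) + \<Phi> t (ennreal \<bar>w2 t\<bar>) \<partial>M)"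
    unfolding modular_def by (intro nn_integral_mono) (auto simp: add_increasing add_increasing2)
  also have "\<dots> = I w1 + I w2" by (simp add: modular_def nn_integral_add)
  finally show ?thesis using assms(4,5) by (auto intro: le_less_trans)
qed

lemma R_glue_tendsto:
  assumes w: "w1 \<in> borel_measurable M" "w2 \<in> borel_measurable M" and I: "I w1 < top" "I w2 < top"
    and E [measurable]: "\<And>n. E n \<in> sets M" and ev: "AE t in M. eventually (\<lambda>n. t \<notin> E n) sequentially"
  shows "(\<lambda>n. R (\<lambda>t. if t \<in> E n then w2 t else w1 t)) \<longlonglongrightarrow> R w1"
proof -
  note [measurable] = w
  have "R (\<lambda>t. if t \<in> E n then w2 t else w1 t) = (LINT t|M. (if t \<in> E n then F w2 t else F w1 t))" for n
    by (subst I_finite(3)) (auto intro!: I_glue_finite w I Bochner_Integration.integral_cong)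
  then show ?thesis
    using integral_glue_tendsto[OF I_finite(2)[OF w(1) I(1)] I_finite(2)[OF w(2) I(2)] E ev] I_finite(3)[OF w(1) I(1)]
    by simp
qed

text \<open>Restricting \<open>w\<close> to the shrinking sets changes \<open>s w\<close> by at most
  \<open>e\<close>, while the modular tends to 0 and the norm bound \<open>1 + I\<close> tends to 1.
  Hence the bound is free of the size of \<open>w\<close>.\<close>

lemma singular_le_dual_norm:
  assumes s: "purely_singular M \<Phi> s" and u: "u \<in> L" "\<not> (AE t in M. u t = 0)"
    and w: "w \<in> borel_measurable M" "I w < top"
  shows "s w \<le> dual_norm M \<Phi> s"
proof (rule field_le_epsilon)
  fix e :: real assume "0 < e"
  note sD = s_dual[OF s]
  let ?\<sigma> = "dual_norm M \<Phi> s"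
  have \<sigma>: "0 \<le> ?\<sigma>" by (rule dual_norm_nonneg[OF u sD])
  obtain E :: "nat \<Rightarrow> 'a set" where E: "\<And>n. E n \<in> sets M" "AE t in M. eventually (\<lambda>n. t \<notin> E n) sequentially"
    "\<And>n. \<bar>s (\<lambda>t. if t \<in> E n then w t else 0) - s w\<bar> \<le> e" "\<And>n. (\<lambda>t. if t \<in> E n then w t else 0) \<in> L"
    using singular_glue[OF s L_zero L_I[OF w] \<open>0 < e\<close>] by blast
  have bound: "s w \<le> ?\<sigma> * (1 + R (\<lambda>t. if t \<in> E n then w t else 0)) + e" for n
  proof -
    have "I (\<lambda>t. if t \<in> E n then w t else 0) < top"
      using I_glue_finite[of "\<lambda>t. 0" w "E n"] w E by simp
    then have "N (\<lambda>t. if t \<in> E n then w t else 0) \<le> 1 + R (\<lambda>t. if t \<in> E n then w t else 0)"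
      using N_le[OF E(4), of 1 n] by simp
    then have "?\<sigma> * N (\<lambda>t. if t \<in> E n then w t else 0) \<le> ?\<sigma> * (1 + R (\<lambda>t. if t \<in> E n then w t else 0))"
      using \<sigma> by (rule mult_left_mono)
    with E(3)[of n] abs_le_dual_norm[OF sD E(4), of n] show ?thesis by linarith
  qed
  have "(\<lambda>n. ?\<sigma> * (1 + R (\<lambda>t. if t \<in> E n then w t else 0)) + e) \<longlonglongrightarrow> ?\<sigma> * (1 + R (\<lambda>t. 0)) + e"
    using w E by (intro tendsto_intros R_glue_tendsto) auto
  then have "s w \<le> ?\<sigma> * (1 + R (\<lambda>t. 0)) + e" using bound by (intro LIMSEQ_le_const) auto
  then show "s w \<le> ?\<sigma> + e" by simp
qed

text \<open>Gluing \<open>w1\<close> off \<open>E n\<close> to \<open>w2\<close> on \<open>E n\<close>, with \<open>E n\<close> shrinking to a null set, makes the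
  integrals tend to those of \<open>w1\<close> while \<open>s\<close> keeps its value at \<open>w2\<close>.\<close>

lemma decoupled_bound:
  assumes s: "purely_singular M \<Phi> s" and v: "v \<in> mo_space M (compl_fun \<Phi>)"
    and le: "\<And>w. w \<in> L \<Longrightarrow> I w < top \<Longrightarrow> (LINT t|M. w t * v t) + s w \<le> 1 + R w"
    and w1: "w1 \<in> borel_measurable M" "I w1 < top" and w2: "w2 \<in> borel_measurable M" "I w2 < top"
  shows "(LINT t|M. w1 t * v t) - R w1 + s w2 \<le> 1"
proof (rule field_le_epsilon)
  fix e :: real assume "0 < e"
  have wL: "w1 \<in> L" "w2 \<in> L" using w1 w2 by (auto intro: L_I)
  obtain E :: "nat \<Rightarrow> 'a set" where E: "\<And>n. E n \<in> sets M" "AE t in M. eventually (\<lambda>n. t \<notin> E n) sequentially"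
    "\<And>n. \<bar>s (\<lambda>t. if t \<in> E n then w2 t else w1 t) - s w2\<bar> \<le> e" "\<And>n. (\<lambda>t. if t \<in> E n then w2 t else w1 t) \<in> L"
    using singular_glue[OF s wL \<open>0 < e\<close>] by blast
  have bound: "(LINT t|M. (if t \<in> E n then w2 t * v t else w1 t * v t)) - R (\<lambda>t. if t \<in> E n then w2 t else w1 t) + s w2 \<le> 1 + e" for n
  proof -
    have "(LINT t|M. (if t \<in> E n then w2 t else w1 t) * v t) = (LINT t|M. (if t \<in> E n then w2 t * v t else w1 t * v t))"
      by (intro Bochner_Integration.integral_cong) auto
    moreover have "(LINT t|M. (if t \<in> E n then w2 t else w1 t) * v t) + s (\<lambda>t. if t \<in> E n then w2 t else w1 t)
      \<le> 1 + R (\<lambda>t. if t \<in> E n then w2 t else w1 t)"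
      using w1 w2 E by (intro le E(4) I_glue_finite) auto
    ultimately show ?thesis using E(3)[of n] by linarith
  qed
  have "(\<lambda>n. (LINT t|M. (if t \<in> E n then w2 t * v t else w1 t * v t)) - R (\<lambda>t. if t \<in> E n then w2 t else w1 t) + s w2)
    \<longlonglongrightarrow> (LINT t|M. w1 t * v t) - R w1 + s w2"
    using w1 w2 E wL v by (intro tendsto_intros R_glue_tendsto integral_glue_tendsto product_integrable) auto
  then show "(LINT t|M. w1 t * v t) - R w1 + s w2 \<le> 1 + e" using bound by (intro LIMSEQ_le_const2) auto
qed

text \<open>After decoupling, the supremum over the function seen by \<open>s\<close> gives its dual
  norm, and then the supremum over the function seen by the integrals gives
  \<open>J v\<close>.\<close>

lemma J_plus_norm_le_1:
  assumes s: "purely_singular M \<Phi> s" and v: "v \<in> mo_space M (compl_fun \<Phi>)"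
    and u: "u \<in> L" "\<not> (AE t in M. u t = 0)"
    and le: "\<And>w. w \<in> L \<Longrightarrow> I w < top \<Longrightarrow> (LINT t|M. w t * v t) + s w \<le> 1 + R w"
  shows "dual_norm M \<Phi> s \<le> 1" "J v \<le> ennreal (1 - dual_norm M \<Phi> s)"
proof -
  note sD = s_dual[OF s]
  have vm [measurable]: "v \<in> borel_measurable M" using v by (simp add: mo_space_def)
  have pair_le: "(LINT t|M. w t * v t) - R w \<le> 1 - dual_norm M \<Phi> s" if w: "w \<in> borel_measurable M" "I w < top" for w
  proof -
    \<comment> \<open>The room left for \<open>s\<close>. Since \<open>c\<close> is nonnegative,
      \<open>s z \<le> c\<close> implies the modular bound with factor \<open>c\<close>, hence dual
      norm at most \<open>c\<close>.\<close>
    define c where "c = 1 - ((LINT t|M. w t * v t) - R w)"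
    have sc: "s z \<le> c" if "z \<in> borel_measurable M" "I z < top" for z
      using decoupled_bound[OF s v le w that] by (simp add: c_def)
    have c: "0 \<le> c" using sc[of "\<lambda>t. 0"] by (simp add: dual_zero[OF sD])
    have "dual_norm M \<Phi> s \<le> c"
    proof (intro dual_norm_le[OF u c] abs_le_N_if_le_modular[OF sD c])
      fix z assume z: "z \<in> L" "I z < top"
      have "s z \<le> c" by (rule sc[OF L_measurable[OF z(1)] z(2)])
      also have "c \<le> c * (1 + R z)" using c by (simp add: algebra_simps)
      finally show "s z \<le> c * (1 + R z)" .
    qed
    then show ?thesis by (simp add: c_def)
  qed
  show le1: "dual_norm M \<Phi> s \<le> 1" using pair_le[of "\<lambda>t. 0"] by simp
  show "J v \<le> ennreal (1 - dual_norm M \<Phi> s)"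
  proof (rule ccontr)
    assume "\<not> ?thesis"
    then have "ennreal (1 - dual_norm M \<Phi> s) < J v" by simp
    then obtain w where w: "w \<in> borel_measurable M" "\<And>t. 0 \<le> w t" "I w < top"
      "ennreal (1 - dual_norm M \<Phi> s) + I w < (\<integral>\<^sup>+ t. ennreal (w t) * ennreal \<bar>v t\<bar> \<partial>M)"
      using compl_modular_approx[OF vm] by blast
    note [measurable] = w(1)
    \<comment> \<open>The sign of \<open>v\<close> turns the pairing with its absolute value into a
      signed pairing without raising the modular.\<close>
    define w' where "w' t = sgn (v t) * w t" for t
    have w'm [measurable]: "w' \<in> borel_measurable M" unfolding w'_def by measurable
    have le: "I w' \<le> I w" by (rule I_mono) (auto simp: w'_def abs_mult abs_sgn_eq)
    then have fin: "I w' < top" using w(3) by (rule le_less_trans)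
    have *: "w' t * v t = w t * \<bar>v t\<bar>" for t by (simp add: w'_def abs_sgn mult_ac)
    have "(\<integral>\<^sup>+ t. ennreal (w t) * ennreal \<bar>v t\<bar> \<partial>M) = (\<integral>\<^sup>+ t. ennreal (w' t * v t) \<partial>M)"
      using w(2) by (simp add: * flip: ennreal_mult)
    also have "\<dots> = ennreal (LINT t|M. w' t * v t)"
      using w(2) by (intro nn_integral_eq_integral product_integrable L_I w'm fin v) (auto simp: *)
    finally have "ennreal (1 - dual_norm M \<Phi> s) + ennreal (R w) < ennreal (LINT t|M. w' t * v t)"
      using w(3,4) by simp
    then have "1 - dual_norm M \<Phi> s + R w < (LINT t|M. w' t * v t)"
      using le1 by (simp add: ennreal_less_iff flip: ennreal_plus)
    moreover have "R w' \<le> R w" using le w(3) by (intro enn2real_mono) auto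
    ultimately show False using pair_le[OF w'm fin] by linarith
  qed
qed

text \<open>The attained infimum equals the finite number \<open>N u\<close>, so a minimiser has
  finite modular and attainment becomes a real equation.\<close>

lemma K_set_iff_norm:
  assumes u: "u \<in> L" and k: "k \<in> K_set M \<Phi> u"
  shows "k > 0" "I (\<lambda>t. k * u t) < top" "k * N u = 1 + R (\<lambda>t. k * u t)"
proof -
  show k0: "k > 0" using k by (simp add: K_set_def)
  have eq: "amemiya M \<Phi> u k = ennreal (N u)" using k by (simp add: K_set_def N_eq_amemiya[OF u])
  then show fin: "I (\<lambda>t. k * u t) < top" using amemiya_top[OF k0, of u] by (cases "I (\<lambda>t. k * u t)") auto
  have "ennreal ((1 + R (\<lambda>t. k * u t)) / k) = ennreal (N u)"
    using eq by (simp only: amemiya_real[OF k0 fin])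
  then have "(1 + R (\<lambda>t. k * u t)) / k = N u" using k0 N_nonneg[OF u] by (subst (asm) ennreal_inj) auto
  then show "k * N u = 1 + R (\<lambda>t. k * u t)" using k0 by (auto simp: field_simps)
qed

text \<open>The Young gap \<open>F w + G v - w * v\<close> is nonnegative almost everywhere, so its
  integral vanishes only if the gap does. A zero gap means agreement of signs together with equality
  in Young's inequality.\<close>

lemma pairing_le_modulars:
  assumes w: "w \<in> borel_measurable M" "I w < top" and v: "v \<in> borel_measurable M" "J v < top"
  shows "(LINT t|M. w t * v t) \<le> R w + enn2real (J v)"
    "(LINT t|M. w t * v t) = R w + enn2real (J v) \<longleftrightarrow>
      (AE t in M. same_sgn (v t) (w t) \<and> ennreal \<bar>v t\<bar> \<in> subdiff \<Phi> t (ennreal \<bar>w t\<bar>))"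
proof -
  have vL: "v \<in> mo_space M (compl_fun \<Phi>)" using v by (intro mo_class_subset) (simp add: mo_class_def)
  have int: "integrable M (\<lambda>t. w t * v t)" by (intro product_integrable L_I w vL)
  have intD: "integrable M (\<lambda>t. F w t + G v t - w t * v t)"
    by (intro Bochner_Integration.integrable_add Bochner_Integration.integrable_diff I_finite[OF w] J_finite[OF v] int)
  have eq: "(LINT t|M. F w t + G v t - w t * v t) = R w + enn2real (J v) - (LINT t|M. w t * v t)"
    using I_finite[OF w] J_finite[OF v] int by simp
  have fin: "AE t in M. \<Phi> t (ennreal \<bar>w t\<bar>) < top \<and> compl_fun \<Phi> t (ennreal \<bar>v t\<bar>) < top"
    using I_finite(1)[OF w] J_finite(1)[OF v] by eventually_elim simp
  have yng: "\<bar>w t\<bar> * \<bar>v t\<bar> \<le> F w t + G v t" and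
    iff: "F w t + G v t - w t * v t = 0 \<longleftrightarrow> same_sgn (v t) (w t) \<and> ennreal \<bar>v t\<bar> \<in> subdiff \<Phi> t (ennreal \<bar>w t\<bar>)"
    if f: "\<Phi> t (ennreal \<bar>w t\<bar>) < top \<and> compl_fun \<Phi> t (ennreal \<bar>v t\<bar>) < top" for t
  proof -
    have sum: "\<Phi> t (ennreal \<bar>w t\<bar>) + compl_fun \<Phi> t (ennreal \<bar>v t\<bar>) = ennreal (F w t + G v t)"
      using f by simp
    have "ennreal (\<bar>w t\<bar> * \<bar>v t\<bar>) \<le> ennreal (F w t + G v t)" unfolding sum[symmetric] by (rule young) auto
    then show le: "\<bar>w t\<bar> * \<bar>v t\<bar> \<le> F w t + G v t" by (subst (asm) ennreal_le_iff) auto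
    \<comment> \<open>Zeros matching either sign is exactly what this identity expresses.\<close>
    have sgn: "same_sgn (v t) (w t) \<longleftrightarrow> w t * v t = \<bar>w t\<bar> * \<bar>v t\<bar>"
      by (auto simp: same_sgn_def sgn_if abs_if)
    have "ennreal \<bar>v t\<bar> \<in> subdiff \<Phi> t (ennreal \<bar>w t\<bar>) \<longleftrightarrow> ennreal (F w t + G v t) = ennreal (\<bar>w t\<bar> * \<bar>v t\<bar>)"
      unfolding sum[symmetric] by (rule mem_subdiff_iff[OF young_function]) (use f in auto)
    also have "\<dots> \<longleftrightarrow> F w t + G v t = \<bar>w t\<bar> * \<bar>v t\<bar>" by (rule ennreal_inj) auto
    finally have sub: "ennreal \<bar>v t\<bar> \<in> subdiff \<Phi> t (ennreal \<bar>w t\<bar>) \<longleftrightarrow> F w t + G v t = \<bar>w t\<bar> * \<bar>v t\<bar>" .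
    have "w t * v t \<le> \<bar>w t\<bar> * \<bar>v t\<bar>" by (metis abs_ge_self abs_mult)
    then show "F w t + G v t - w t * v t = 0 \<longleftrightarrow> same_sgn (v t) (w t) \<and> ennreal \<bar>v t\<bar> \<in> subdiff \<Phi> t (ennreal \<bar>w t\<bar>)"
      unfolding sgn sub using le by auto
  qed
  have nn: "AE t in M. 0 \<le> F w t + G v t - w t * v t"
    using fin
  proof eventually_elim
    case (elim t)
    have "w t * v t \<le> \<bar>w t\<bar> * \<bar>v t\<bar>" by (metis abs_ge_self abs_mult)
    then show ?case using yng[OF elim] by simp
  qed
  have "0 \<le> (LINT t|M. F w t + G v t - w t * v t)" using nn by (rule integral_nonneg_AE)
  then show "(LINT t|M. w t * v t) \<le> R w + enn2real (J v)" unfolding eq by simp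
  have "(LINT t|M. w t * v t) = R w + enn2real (J v) \<longleftrightarrow> (LINT t|M. F w t + G v t - w t * v t) = 0"
    unfolding eq by auto
  also have "\<dots> \<longleftrightarrow> (AE t in M. F w t + G v t - w t * v t = 0)"
    using intD nn by (rule integral_nonneg_eq_0_iff_AE)
  also have "\<dots> \<longleftrightarrow> (AE t in M. same_sgn (v t) (w t) \<and> ennreal \<bar>v t\<bar> \<in> subdiff \<Phi> t (ennreal \<bar>w t\<bar>))"
    by (rule eventually_cong[OF fin iff])
  finally show "(LINT t|M. w t * v t) = R w + enn2real (J v) \<longleftrightarrow>
      (AE t in M. same_sgn (v t) (w t) \<and> ennreal \<bar>v t\<bar> \<in> subdiff \<Phi> t (ennreal \<bar>w t\<bar>))" .
qed

lemma same_sgn_scale: "0 < k \<Longrightarrow> same_sgn y (k * x) \<longleftrightarrow> same_sgn y x"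
  by (auto simp: same_sgn_def sgn_mult)

text \<open>The equivalence for one fixed minimiser \<open>k\<close>; both directions evaluate
  \<open>f\<close> at \<open>k * u\<close> and compare with \<open>1 + I (k * u)\<close>.\<close>

theorem support_functional_iff:
  assumes u: "u \<in> L" "\<not> (AE t in M. u t = 0)" and k: "k \<in> K_set M \<Phi> u"
    and f: "f \<in> D" and comp: "has_components M \<Phi> f v s"
  shows "support_functional M \<Phi> f u \<longleftrightarrow>
       J v + ennreal (dual_norm M \<Phi> s) = 1 \<and>
       dual_norm M \<Phi> s = s (\<lambda>t. k * u t) \<and>
       (AE t in M. same_sgn (v t) (u t) \<and> ennreal \<bar>v t\<bar> \<in> subdiff \<Phi> t (ennreal \<bar>k * u t\<bar>))"
    (is "_ \<longleftrightarrow> ?i \<and> ?ii \<and> ?iii")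
proof -
  have v: "v \<in> mo_space M (compl_fun \<Phi>)" and s: "purely_singular M \<Phi> s"
    and fdec: "\<And>w. w \<in> L \<Longrightarrow> f w = (LINT t|M. w t * v t) + s w"
    using comp by (auto simp: has_components_def)
  note sD = s_dual[OF s]
  note K = K_set_iff_norm[OF u(1) k]
  have vm: "v \<in> borel_measurable M" using v by (simp add: mo_space_def)
  have kum: "(\<lambda>t. k * u t) \<in> borel_measurable M" using L_measurable[OF u(1)] by simp
  have kuL: "(\<lambda>t. k * u t) \<in> L" by (rule L_scale[OF u(1)])
  let ?\<sigma> = "dual_norm M \<Phi> s"
  have \<sigma>0: "0 \<le> ?\<sigma>" by (rule dual_norm_nonneg[OF u sD])
  have iii: "?iii \<longleftrightarrow> (LINT t|M. k * u t * v t) = R (\<lambda>t. k * u t) + enn2real (J v)" if "J v < top"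
    using pairing_le_modulars(2)[OF kum K(2) vm that] by (simp add: same_sgn_scale[OF K(1)])
  show ?thesis
  proof
    assume sf: "support_functional M \<Phi> f u"
    have fN: "f w \<le> N w" if "w \<in> L" for w
      using abs_le_dual_norm[OF f that] sf by (simp add: support_functional_def)
    have le: "(LINT t|M. w t * v t) + s w \<le> 1 + R w" if w: "w \<in> L" "I w < top" for w
      using fN[OF w(1)] N_le[OF w(1), of 1] w fdec[OF w(1)] by simp
    have J: "?\<sigma> \<le> 1" "J v \<le> ennreal (1 - ?\<sigma>)" using J_plus_norm_le_1[OF s v u] le by blast+
    have Jfin: "J v < top" using J(2) by (rule le_less_trans) (rule ennreal_less_top)
    have J': "enn2real (J v) \<le> 1 - ?\<sigma>" using J by (simp add: enn2real_leI)
    have "(LINT t|M. k * u t * v t) + s (\<lambda>t. k * u t) = f (\<lambda>t. k * u t)" using fdec[OF kuL] by simp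
    also have "\<dots> = k * N u" using sf dual_scale[OF f u(1)] by (simp add: support_functional_def)
    also have "\<dots> = 1 + R (\<lambda>t. k * u t)" by (rule K(3))
    finally have total: "(LINT t|M. k * u t * v t) + s (\<lambda>t. k * u t) = 1 + R (\<lambda>t. k * u t)" .
    have a: "s (\<lambda>t. k * u t) \<le> ?\<sigma>" by (rule singular_le_dual_norm[OF s u kum K(2)])
    have b: "(LINT t|M. k * u t * v t) \<le> R (\<lambda>t. k * u t) + enn2real (J v)"
      by (rule pairing_le_modulars(1)[OF kum K(2) vm Jfin])
    \<comment> \<open>Three upper bounds whose sum is attained must each be attained.\<close>
    have 1: "s (\<lambda>t. k * u t) = ?\<sigma>" "enn2real (J v) = 1 - ?\<sigma>"
      "(LINT t|M. k * u t * v t) = R (\<lambda>t. k * u t) + enn2real (J v)"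
      using total a b J' by linarith+
    have "J v = ennreal (1 - ?\<sigma>)" using 1(2) Jfin by (metis ennreal_enn2real)
    then have ?i using J(1) \<sigma>0 by (simp flip: ennreal_plus)
    then show "?i \<and> ?ii \<and> ?iii" using 1 iii[OF Jfin] by simp
  next
    assume cond: "?i \<and> ?ii \<and> ?iii"
    then have i: ?i and ii: ?ii and iii': ?iii by auto
    have "J v \<le> 1" using i by (metis le_iff_add)
    then have Jfin: "J v < top" by (rule le_less_trans) simp
    have "ennreal (enn2real (J v) + ?\<sigma>) = ennreal 1" using i Jfin \<sigma>0 by simp
    then have J1: "enn2real (J v) + ?\<sigma> = 1" using \<sigma>0 by (subst (asm) ennreal_inj) auto
    have fI: "f w \<le> 1 * (1 + R w)" if w: "w \<in> L" "I w < top" for w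
      using pairing_le_modulars(1)[OF L_measurable[OF w(1)] w(2) vm Jfin]
        singular_le_dual_norm[OF s u L_measurable[OF w(1)] w(2)] fdec[OF w(1)] J1 by simp
    have fN: "\<bar>f w\<bar> \<le> 1 * N w" if "w \<in> L" for w
      using abs_le_N_if_le_modular[OF f _ fI that] by simp
    have le1: "dual_norm M \<Phi> f \<le> 1" using dual_norm_le[OF u _ fN] by simp
    have "k * f u = f (\<lambda>t. k * u t)" by (simp add: dual_scale[OF f u(1)])
    also have "\<dots> = R (\<lambda>t. k * u t) + enn2real (J v) + ?\<sigma>"
      using fdec[OF kuL] iii[OF Jfin] iii' ii by simp
    also have "\<dots> = k * N u" using K(3) J1 by simp
    finally have fu: "f u = N u" using K(1) by simp
    \<comment> \<open>The summand 1 makes \<open>N u\<close> positive, so \<open>u\<close> itself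
      witnesses that the dual norm is at least 1.\<close>
    have "0 < k * N u" unfolding K(3) by (simp add: add_pos_nonneg)
    then have Npos: "0 < N u" using K(1) by (simp add: zero_less_mult_iff)
    have "1 \<le> dual_norm M \<Phi> f" using abs_le_dual_norm[OF f u(1)] fu Npos by simp
    then show "support_functional M \<Phi> f u" using f fu le1 by (simp add: support_functional_def)
  qed
qed

end

section \<open>Changing the Musielak-Orlicz function on a null set\<close>

context
  fixes M :: "'a measure" and \<Phi> \<Psi> :: "'a \<Rightarrow> ennreal \<Rightarrow> ennreal"
  assumes ae: "AE t in M. \<Phi> t = \<Psi> t"
begin

lemma compl_fun_pointwise_cong: "\<Phi> t = \<Psi> t \<Longrightarrow> compl_fun \<Phi> t = compl_fun \<Psi> t"
  by (simp add: fun_eq_iff compl_fun_def)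

lemma subdiff_pointwise_cong: "\<Phi> t = \<Psi> t \<Longrightarrow> subdiff \<Phi> t = subdiff \<Psi> t"
  unfolding subdiff_def left_deriv_def right_deriv_def by (intro ext) (simp only:)

lemma modular_AE_cong: "modular M \<Phi> = modular M \<Psi>"
  unfolding modular_def fun_eq_iff
  by (intro allI nn_integral_cong_AE, use ae in eventually_elim) simp

lemma modular_compl_AE_cong: "modular M (compl_fun \<Phi>) = modular M (compl_fun \<Psi>)"
  unfolding modular_def fun_eq_iff
  by (intro allI nn_integral_cong_AE, use ae in eventually_elim) (simp add: compl_fun_pointwise_cong)

lemma mo_space_AE_cong: "mo_space M \<Phi> = mo_space M \<Psi>"
  "mo_space M (compl_fun \<Phi>) = mo_space M (compl_fun \<Psi>)"
  by (simp_all add: mo_space_def modular_AE_cong modular_compl_AE_cong)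

lemma orlicz_norm_AE_cong: "orlicz_norm M \<Phi> = orlicz_norm M \<Psi>"
  by (simp add: fun_eq_iff orlicz_norm_def mo_class_def modular_compl_AE_cong)

lemma K_set_AE_cong: "K_set M \<Phi> = K_set M \<Psi>"
  by (simp add: fun_eq_iff K_set_def amemiya_def modular_AE_cong)

lemma mo_dual_AE_cong: "mo_dual M \<Phi> = mo_dual M \<Psi>"
  by (simp add: mo_dual_def mo_space_AE_cong orlicz_norm_AE_cong)

lemma dual_norm_AE_cong: "dual_norm M \<Phi> = dual_norm M \<Psi>"
  by (simp add: fun_eq_iff dual_norm_def mo_space_AE_cong orlicz_norm_AE_cong)

lemma support_functional_AE_cong: "support_functional M \<Phi> = support_functional M \<Psi>"
  by (simp add: fun_eq_iff support_functional_def mo_dual_AE_cong dual_norm_AE_cong orlicz_norm_AE_cong)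

lemma has_components_AE_cong: "has_components M \<Phi> = has_components M \<Psi>"
proof -
  have "pos_part_fun M \<Phi> = pos_part_fun M \<Psi>"
    by (simp add: fun_eq_iff pos_part_fun_def mo_space_AE_cong)
  moreover have "oc_part_pos M \<Phi> = oc_part_pos M \<Psi>"
    by (simp add: fun_eq_iff oc_part_pos_def mo_space_AE_cong)
  ultimately have "oc_part M \<Phi> = oc_part M \<Psi>"
    by (intro ext) (simp add: oc_part_def)
  then show ?thesis
    by (simp add: fun_eq_iff has_components_def purely_singular_def mo_space_AE_cong mo_dual_AE_cong)
qed

end

lemma young_function_id: "young_function (\<lambda>x. x)"
proof
  show "lsc_ext (\<lambda>x. x)" unfolding lsc_ext_def
    by (auto simp: le_Liminf_iff intro: order_tendstoD(1)[OF tendsto_ident_at])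
qed (simp_all add: convex_ext_def)

text \<open>The identity replaces sections on a measurable null set containing the bad points, and
  also outside the space, because \<open>mo_setting\<close> speaks of all \<open>t\<close>.
  Measurability for constant arguments survives, as the null set is measurable.\<close>

lemma everywhere_version:
  assumes "sigma_finite_measure M" "musielak_orlicz M \<Phi>"
  obtains \<Psi> where "mo_setting M \<Psi>" "AE t in M. \<Phi> t = \<Psi> t"
proof -
  interpret sigma_finite_measure M by fact
  have "AE t in M. young_function (\<Phi> t)"
    using assms(2) by (auto simp: musielak_orlicz_def young_function_def elim!: eventually_mono)
  then obtain A where A: "{t \<in> space M. \<not> young_function (\<Phi> t)} \<subseteq> A" "emeasure M A = 0" "A \<in> sets M"
    by (rule AE_E)
  note [measurable] = A(3)
  define \<Psi> where "\<Psi> t = (if t \<in> space M - A then \<Phi> t else (\<lambda>x. x))" for t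
  have "mo_setting M \<Psi>"
  proof (intro mo_setting.intro mo_setting_axioms.intro)
    show "sigma_finite_measure M" by fact
    show "young_function (\<Psi> t)" for t using A(1) young_function_id by (auto simp: \<Psi>_def)
    fix x :: real assume "0 \<le> x"
    then have [measurable]: "(\<lambda>t. \<Phi> t (ennreal x)) \<in> borel_measurable M"
      using assms(2) by (simp add: musielak_orlicz_def)
    have "(\<lambda>t. if t \<in> A then ennreal x else \<Phi> t (ennreal x)) \<in> borel_measurable M" by measurable
    then show "(\<lambda>t. \<Psi> t (ennreal x)) \<in> borel_measurable M"
      by (rule measurable_cong[THEN iffD1, rotated]) (simp add: \<Psi>_def)
  qed
  moreover have "AE t in M. \<Phi> t = \<Psi> t"
    using A by (intro AE_I[of _ _ A]) (auto simp: \<Psi>_def)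
  ultimately show thesis by (rule that)
qed

theorem proposition9:
  fixes M :: "'a measure"
    and \<Phi> :: "'a \<Rightarrow> ennreal \<Rightarrow> ennreal"
    and u v :: "'a \<Rightarrow> real"
    and f s :: "('a \<Rightarrow> real) \<Rightarrow> real"
  assumes "sigma_finite_measure M" and "nonatomic M"
    and "musielak_orlicz M \<Phi>"
    and "u \<in> mo_space M \<Phi>" and "\<not> (AE t in M. u t = 0)"
    and "K_set M \<Phi> u \<noteq> {}"
    and "f \<in> mo_dual M \<Phi>" and "has_components M \<Phi> f v s"
  shows "support_functional M \<Phi> f u \<longleftrightarrow>
    (\<forall>k\<in>K_set M \<Phi> u.
       modular M (compl_fun \<Phi>) v + ennreal (dual_norm M \<Phi> s) = 1 \<and>
       dual_norm M \<Phi> s = s (\<lambda>t. k * u t) \<and>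
       (AE t in M. same_sgn (v t) (u t) \<and>
                   ennreal \<bar>v t\<bar> \<in> subdiff \<Phi> t (ennreal \<bar>k * u t\<bar>)))"
proof -
  obtain \<Psi> where "mo_setting M \<Psi>" and ae: "AE t in M. \<Phi> t = \<Psi> t"
    using everywhere_version assms(1,3) by blast
  interpret mo_setting M \<Psi> by fact
  have sub: "(AE t in M. same_sgn (v t) (u t) \<and> ennreal \<bar>v t\<bar> \<in> subdiff \<Phi> t (ennreal \<bar>k * u t\<bar>)) \<longleftrightarrow>
    (AE t in M. same_sgn (v t) (u t) \<and> ennreal \<bar>v t\<bar> \<in> subdiff \<Psi> t (ennreal \<bar>k * u t\<bar>))" for k
    by (rule eventually_cong[OF ae]) (simp add: subdiff_pointwise_cong[OF ae])
  have "support_functional M \<Psi> f u \<longleftrightarrow>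
       modular M (compl_fun \<Psi>) v + ennreal (dual_norm M \<Psi> s) = 1 \<and>
       dual_norm M \<Psi> s = s (\<lambda>t. k * u t) \<and>
       (AE t in M. same_sgn (v t) (u t) \<and> ennreal \<bar>v t\<bar> \<in> subdiff \<Psi> t (ennreal \<bar>k * u t\<bar>))"
    if "k \<in> K_set M \<Psi> u" for k
    using assms(4,5) that assms(7,8)
    unfolding mo_space_AE_cong[OF ae] mo_dual_AE_cong[OF ae] has_components_AE_cong[OF ae]
    by (rule support_functional_iff)
  \<comment> \<open>The equivalence holds for each \<open>k\<close> separately; nonemptiness of
    \<open>K_set\<close> supplies a \<open>k\<close> for the direction from the conditions to the
    support property.\<close>
  with assms(6) show ?thesis
    unfolding support_functional_AE_cong[OF ae] modular_compl_AE_cong[OF ae] dual_norm_AE_cong[OF ae]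
      K_set_AE_cong[OF ae] sub by blast
qed

end
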